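(* Assume (A) and (B) with $p\in(1,\frac{1+s}{1-s})$. Let $u\in H^{s/2}$ be a weak solution of one of the following: - $Lu+cu-f(u)=0$ with $c>0$; - $c(Lu+u)-f(u)=0$ with $c>0$; - $cLu+(c-1)u-f(u)=0$ with $c>1$. Then $u\in H^s(\mathbb R)$.
   Context: Fourier transform: $\hat u(\xi)=\int e^{-2\pi ix\xi}u(x)\,dx$. $H^r(\mathbb R)$ is the Sobolev space with norm $\left(\int(1+|\xi|^2)^r|\hat u|^2\,d\xi\right)^{1/2}$. Assumption (A): $s>0$ and $L$ is the Fourier multiplier $\widehat{Lu}=m\hat u$, where $m$ is piecewise continuous with finitely many discontinuities and there are $A_1,A_2>0$ with $A_1|\xi|^s\le m(\xi)\le A_2|\xi|^s$ for $|\xi|\ge1$ and $0\le m(\xi)\le A_2$ for $|\xi|\le1$. Assumption (B): $f(u)=c_pu|u|^{p-1}$ with $c_p>0$ (B1), or $f(u)=c_p|u|^p$ with $c_p\ne0$ (B2), where $p>1$. When $s\ge1$, $(1,\frac{1+s}{1-s})$ means $(1,\infty)$. *)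

theory Defs
  imports "HOL-Analysis.Analysis"
begin

definition ft_trunc :: "(real \<Rightarrow> real) \<Rightarrow> real \<Rightarrow> real \<Rightarrow> complex" where
  "ft_trunc u R \<xi> = (LINT x:{-R..R}|lborel. cis (- 2 * pi * x * \<xi>) * complex_of_real (u x))"

text \<open>U is the (Plancherel, L^2) Fourier transform of u: the L^2-limit of the truncated
  Fourier integrals as R tends to infinity.\<close>
definition is_fourier :: "(real \<Rightarrow> real) \<Rightarrow> (real \<Rightarrow> complex) \<Rightarrow> bool" where
  "is_fourier u U \<longleftrightarrow>
     U \<in> borel_measurable lborel \<and>
     ((\<lambda>R. \<integral>\<^sup>+ \<xi>. ennreal ((cmod (ft_trunc u R \<xi> - U \<xi>))\<^sup>2) \<partial>lborel) \<longlongrightarrow> 0) at_top"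

definition sobolev :: "real \<Rightarrow> (real \<Rightarrow> real) set" where
  "sobolev r = {u. u \<in> borel_measurable lborel \<and> integrable lborel (\<lambda>x. (u x)\<^sup>2) \<and>
     (\<exists>U. is_fourier u U \<and> integrable lborel (\<lambda>\<xi>. (1 + \<xi>\<^sup>2) powr r * (cmod (U \<xi>))\<^sup>2))}"

definition assumption_A :: "real \<Rightarrow> (real \<Rightarrow> real) \<Rightarrow> bool" where
  "assumption_A s m \<longleftrightarrow> s > 0 \<and>
     (\<exists>D. finite D \<and> continuous_on (UNIV - D) m \<and>
        (\<forall>d\<in>D. (\<exists>l. (m \<longlongrightarrow> l) (at_left d)) \<and> (\<exists>r. (m \<longlongrightarrow> r) (at_right d)))) \<and>
     (\<exists>A1 A2. A1 > 0 \<and> A2 > 0 \<and>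
        (\<forall>\<xi>. \<bar>\<xi>\<bar> \<ge> 1 \<longrightarrow> A1 * \<bar>\<xi>\<bar> powr s \<le> m \<xi> \<and> m \<xi> \<le> A2 * \<bar>\<xi>\<bar> powr s) \<and>
        (\<forall>\<xi>. \<bar>\<xi>\<bar> \<le> 1 \<longrightarrow> 0 \<le> m \<xi> \<and> m \<xi> \<le> A2))"

definition assumption_B :: "real \<Rightarrow> (real \<Rightarrow> real) \<Rightarrow> bool" where
  "assumption_B p f \<longleftrightarrow> p > 1 \<and>
     ((\<exists>cp>0. f = (\<lambda>u. cp * u * \<bar>u\<bar> powr (p - 1))) \<or>
      (\<exists>cp. cp \<noteq> 0 \<and> f = (\<lambda>u. cp * \<bar>u\<bar> powr p)))"

text \<open>Weak solution of  a L u + b u - f(u) = 0, tested against all phi in H^{s/2}: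
  a <Lu, phi> + b <u, phi> - <f(u), phi> = 0, where <Lu, phi> = int m U conj(V).\<close>
definition weak_solution ::
  "real \<Rightarrow> (real \<Rightarrow> real) \<Rightarrow> (real \<Rightarrow> real) \<Rightarrow> real \<Rightarrow> real \<Rightarrow> (real \<Rightarrow> real) \<Rightarrow> bool" where
  "weak_solution s m f a b u \<longleftrightarrow>
     (\<forall>\<phi> U V. \<phi> \<in> sobolev (s / 2) \<longrightarrow> is_fourier u U \<longrightarrow> is_fourier \<phi> V \<longrightarrow>
        complex_of_real a * (LINT \<xi>|lborel. complex_of_real (m \<xi>) * U \<xi> * cnj (V \<xi>))
        + complex_of_real (b * (LINT x|lborel. u x * \<phi> x))
        - complex_of_real (LINT x|lborel. f (u x) * \<phi> x) = 0)"

end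

theory Submission
  imports Defs "HOL-Probability.Characteristic_Functions"
begin

text \<open>
  Write \<open>J(\<xi>) = 1 + \<xi>\<^sup>2\<close>. Testing the equation with the inverse transform of \<open>J powr (t - s/2)\<close> times the
  transform of \<open>u\<close>, cut off at \<open>|\<xi>| \<le> N\<close>, and using \<open>a m + b \<ge> k J powr (s/2)\<close>, one sees that \<open>u\<close> lies in
  \<open>H\<^sup>t\<close> with \<open>t = s - \<sigma>\<close> as soon as the functional \<open>\<phi> \<mapsto> \<integral> f(u) \<phi>\<close> is bounded on the unit ball of \<open>H\<^sup>\<sigma>\<close>.
  If \<open>u\<close> lies in \<open>H\<^sup>r\<close>, the Sobolev embedding \<open>H\<^sup>r \<subseteq> L\<^sup>q\<close>, \<open>q = 2/(1-2r)\<close>, applied to both \<open>u\<close> and \<open>\<phi>\<close>, together with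
  Young's inequality, gives this for \<open>\<sigma> = (p(1-2r) - 1)/2\<close>. The gain \<open>t - r\<close> is at least
  \<open>s - (p-1)(1-s)/2\<close>, which is positive exactly in the subcritical range, so finitely many steps
  reach \<open>p(1-2r) = 1\<close>, where \<open>\<sigma> = 0\<close> and \<open>t = s\<close>. Plancherel's theorem, from which the
  Fourier side of all this follows, is obtained by recognising \<open>|ft g|\<^sup>2\<close> as the transform of the
  autocorrelation of \<open>g\<close> and recovering the value of the latter at 0 with Gaussian weights.
\<close>

section \<open>Continuity of translations in L1\<close>

text \<open>Test functions are real, so every multiplier applied to \<open>U\<close> has to be even
  and \<open>U\<close> itself Hermitian, which must be extracted from its definition as an L2 limit.
  The frequency cutoff puts the test function into every Sobolev space, in particular into H^(s/2),
  and makes the energy \<open>E\<close> to be bounded finite beforehand. An inequality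
  \<open>k * E \<le> K * sqrt E\<close> can then be divided by \<open>sqrt E\<close>; the resulting
  bound does not depend on \<open>N\<close>, and Fatou's lemma removes the cutoff. The nonlinearity
  is seen only through its pairing with test functions. The iteration stops at the \<open>R\<close>
  with \<open>p * (1 - 2 * R) = 1\<close>, beyond which \<sigma> would be negative. As
  \<open>R < 1/2\<close>, the endpoint r = 1/2, where the embedding exponent blows up, is never met.
  In Plancherel's theorem the obstacle is that the autocorrelation of a merely integrable function
  need not be continuous at 0. The Gaussian argument is therefore run for bounded functions, where
  this follows from continuity of translations in L1, and is then extended by truncating
  values.\<close>

lemma integrable_translate:
  fixes g :: "real \<Rightarrow> 'a::{banach, second_countable_topology}"
  assumes "integrable lborel g"
  shows "integrable lborel (\<lambda>x. g (x + h))"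
  using lborel_integrable_real_affine[OF assms, of 1 h] by (simp add: add.commute)

lemma integral_translate:
  fixes g :: "real \<Rightarrow> 'a::{banach, second_countable_topology}"
  shows "(LINT x|lborel. g (x + h)) = (LINT x|lborel. g x)"
  using lborel_integral_real_affine[of 1 g h] by (simp add: add.commute)

text \<open>Since the two integrals agree, only the positive part of the difference matters, and on an
  open set it tends to 0 pointwise.\<close>
lemma translate_indicator_open_tendsto_0:
  fixes U :: "real set"
  assumes "open U" and fin: "emeasure lborel U < \<infinity>"
  shows "((\<lambda>h. LINT x|lborel. \<bar>indicat_real U (x + h) - indicat_real U x\<bar>) \<longlongrightarrow> 0) (at 0)"
proof (rule tendsto_at_iff_sequentially[THEN iffD2], intro allI impI)
  fix X :: "nat \<Rightarrow> real" assume X: "\<forall>i. X i \<in> UNIV - {0}" "X \<longlonglongrightarrow> 0"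
  have [measurable]: "U \<in> sets borel" using assms(1) by simp
  have int: "integrable lborel (indicat_real U)" using fin by simp
  have int': "integrable lborel (\<lambda>x. indicat_real U (x + h))" for h
    by (rule integrable_translate[OF int])
  have eq: "(LINT x|lborel. \<bar>indicat_real U (x + h) - indicat_real U x\<bar>)
      = 2 * (LINT x|lborel. max 0 (indicat_real U x - indicat_real U (x + h)))" for h
  proof -
    have "(LINT x|lborel. \<bar>indicat_real U (x + h) - indicat_real U x\<bar>)
      = (LINT x|lborel. 2 * max 0 (indicat_real U x - indicat_real U (x + h)) + (indicat_real U (x + h) - indicat_real U x))"
      by (intro Bochner_Integration.integral_cong) (auto simp: indicator_def)
    also have "\<dots> = 2 * (LINT x|lborel. max 0 (indicat_real U x - indicat_real U (x + h)))"
      using int int' integral_translate[of "indicat_real U" h] by simp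
    finally show ?thesis .
  qed
  have "(\<lambda>n. LINT x|lborel. max 0 (indicat_real U x - indicat_real U (x + X n))) \<longlonglongrightarrow> (LINT x::real|lborel. 0::real)"
  proof (rule integral_dominated_convergence[OF _ _ int])
    show "AE x in lborel. (\<lambda>n. max 0 (indicat_real U x - indicat_real U (x + X n))) \<longlonglongrightarrow> 0"
    proof (rule AE_I2)
      fix x :: real
      show "(\<lambda>n. max 0 (indicat_real U x - indicat_real U (x + X n))) \<longlonglongrightarrow> 0"
      proof (cases "x \<in> U")
        case True
        have "(\<lambda>n. x + X n) \<longlonglongrightarrow> x" using tendsto_add[OF tendsto_const X(2), of x] by simp
        then have "eventually (\<lambda>n. x + X n \<in> U) sequentially"
          using topological_tendstoD[OF _ assms(1) True] by blast
        then have "eventually (\<lambda>n. max 0 (indicat_real U x - indicat_real U (x + X n)) = 0) sequentially"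
          by eventually_elim (auto simp: indicator_def)
        then show ?thesis by (rule tendsto_eventually)
      next
        case False
        then show ?thesis by (simp add: indicator_def)
      qed
    qed
  qed (auto simp: indicator_def)
  from tendsto_mult[OF tendsto_const[of 2] this]
  show "((\<lambda>h. LINT x|lborel. \<bar>indicat_real U (x + h) - indicat_real U x\<bar>) \<circ> X) \<longlonglongrightarrow> 0"
    by (simp add: o_def eq)
qed

text \<open>A three-epsilon argument: the translated error \<open>g (x + h) - f (x + h)\<close> has
  the same integral norm as the untranslated one. It serves both the passage from open to Borel sets
  and the passage to dominated limits.\<close>

lemma translate_tendsto_0_approx:
  fixes g :: "real \<Rightarrow> 'a::{banach, second_countable_topology}"
  assumes g: "integrable lborel g"
    and approx: "\<And>e. e > 0 \<Longrightarrow> \<exists>f. integrable lborel f \<and> (LINT x|lborel. norm (g x - f x)) < e \<and>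
        ((\<lambda>h. LINT x|lborel. norm (f (x + h) - f x)) \<longlongrightarrow> 0) (at 0)"
  shows "((\<lambda>h. LINT x|lborel. norm (g (x + h) - g x)) \<longlongrightarrow> 0) (at 0)"
proof (rule tendstoI)
  fix e :: real assume e: "e > 0"
  obtain f where f: "integrable lborel f" "(LINT x|lborel. norm (g x - f x)) < e / 3"
    and lim: "((\<lambda>h. LINT x|lborel. norm (f (x + h) - f x)) \<longlongrightarrow> 0) (at 0)"
    using approx[of "e / 3"] e by auto
  have "eventually (\<lambda>h. dist (LINT x|lborel. norm (f (x + h) - f x)) 0 < e / 3) (at 0)"
    using tendstoD[OF lim, of "e / 3"] e by simp
  then show "eventually (\<lambda>h. dist (LINT x|lborel. norm (g (x + h) - g x)) 0 < e) (at 0)"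
  proof eventually_elim
    case (elim h)
    note T = integrable_translate[of _ h]
    have "(LINT x|lborel. norm (g (x + h) - g x))
        \<le> (LINT x|lborel. norm (g (x + h) - f (x + h)) + norm (f (x + h) - f x) + norm (g x - f x))"
    proof (rule integral_mono)
      fix x
      show "norm (g (x + h) - g x) \<le> norm (g (x + h) - f (x + h)) + norm (f (x + h) - f x) + norm (g x - f x)"
        using norm_triangle_ineq[of "g (x + h) - f (x + h) + (f (x + h) - f x)" "f x - g x"]
          norm_triangle_ineq[of "g (x + h) - f (x + h)" "f (x + h) - f x"]
        by (simp add: norm_minus_commute)
    qed (use g f T[OF g] T[OF f(1)] in auto)
    also have "\<dots> = (LINT x|lborel. norm (g (x + h) - f (x + h))) + (LINT x|lborel. norm (f (x + h) - f x)) + (LINT x|lborel. norm (g x - f x))"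
      using g f T[OF g] T[OF f(1)] by simp
    also have "(LINT x|lborel. norm (g (x + h) - f (x + h))) = (LINT x|lborel. norm (g x - f x))"
      by (rule integral_translate[of "\<lambda>x. norm (g x - f x)"])
    finally have "(LINT x|lborel. norm (g (x + h) - g x)) < e" using f(2) elim by simp
    then show ?case by simp
  qed
qed

text \<open>Indicators come first: outer regularity replaces a Borel set by an open one, for which
  the claim is already known. Sums and dominated limits then reach every integrable
  function.\<close>

lemma translate_tendsto_0:
  fixes g :: "real \<Rightarrow> 'a::{banach, second_countable_topology}"
  assumes "integrable lborel g"
  shows "((\<lambda>h. LINT x|lborel. norm (g (x + h) - g x)) \<longlongrightarrow> 0) (at 0)"
  using assms
proof (induction rule: integrable_induct)
  case (base A c)
  have A[measurable]: "A \<in> sets borel" using base by simp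
  have intA: "integrable lborel (indicat_real A)" using base by simp
  have "((\<lambda>h. LINT x|lborel. norm (indicat_real A (x + h) - indicat_real A x)) \<longlongrightarrow> 0) (at 0)"
  proof (rule translate_tendsto_0_approx[OF intA])
    fix e :: real assume e: "e > 0"
    obtain U where U: "open U" "A \<subseteq> U" "emeasure lborel (U - A) < e"
      using outer_regular_lborel[OF A e] by blast
    have [measurable]: "U \<in> sets borel" using U by simp
    have "emeasure lborel U \<le> emeasure lborel A + emeasure lborel (U - A)"
      using U(2) by (metis A Diff_partition \<open>U \<in> sets borel\<close> emeasure_subadditive sets.Diff sets_lborel)
    also have "\<dots> < \<infinity>" using base(2) U(3) by (auto simp: less_top[symmetric] top_unique)
    finally have fin: "emeasure lborel U < \<infinity>" .
    have "(LINT x|lborel. norm (indicat_real A x - indicat_real U x)) = (LINT x|lborel. indicator (U - A) x)"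
      using U(2) by (intro Bochner_Integration.integral_cong) (auto simp: indicator_def)
    also have "\<dots> = measure lborel (U - A)" by simp
    also have "\<dots> < e"
      using U(3) e order.strict_trans[OF U(3) ennreal_less_top] by (simp add: measure_def enn2real_less_iff)
    finally show "\<exists>f. integrable lborel f \<and> (LINT x|lborel. norm (indicat_real A x - f x)) < e \<and>
        ((\<lambda>h. LINT x|lborel. norm (f (x + h) - f x)) \<longlongrightarrow> 0) (at 0)"
      using fin translate_indicator_open_tendsto_0[OF U(1) fin]
      by (intro exI[of _ "indicat_real U"]) auto
  qed
  from tendsto_mult_left[OF this, of "norm c"]
  show ?case
    by (simp flip: scaleR_diff_left add: mult.commute)
next
  case (add f g)
  note T = integrable_translate
  show ?case
  proof (rule tendsto_sandwich[OF _ _ tendsto_const])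
    show "\<forall>\<^sub>F h in at 0. 0 \<le> (LINT x|lborel. norm (f (x + h) + g (x + h) - (f x + g x)))"
      by simp
    show "\<forall>\<^sub>F h in at 0. (LINT x|lborel. norm (f (x + h) + g (x + h) - (f x + g x)))
        \<le> (LINT x|lborel. norm (f (x + h) - f x)) + (LINT x|lborel. norm (g (x + h) - g x))"
    proof (rule always_eventually, rule allI)
      fix h :: real
      have "(LINT x|lborel. norm (f (x + h) + g (x + h) - (f x + g x)))
          \<le> (LINT x|lborel. norm (f (x + h) - f x) + norm (g (x + h) - g x))"
        using add T[of f h] T[of g h] by (intro integral_mono) (auto intro: norm_diff_triangle_ineq)
      then show "(LINT x|lborel. norm (f (x + h) + g (x + h) - (f x + g x)))
        \<le> (LINT x|lborel. norm (f (x + h) - f x)) + (LINT x|lborel. norm (g (x + h) - g x))"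
        using add T[of f h] T[of g h] by simp
    qed
    show "((\<lambda>h. (LINT x|lborel. norm (f (x + h) - f x)) + (LINT x|lborel. norm (g (x + h) - g x))) \<longlongrightarrow> 0) (at 0)"
      using tendsto_add[OF add.IH] by simp
  qed
next
  case (lim f s)
  note [measurable] = borel_measurable_integrable[OF lim.hyps(4)] borel_measurable_integrable[OF lim.hyps(1)]
  \<comment> \<open>The factor 3 in the majorant arises because the induction rule supplies
    approximants with \<open>norm (s i x) \<le> 2 * norm (f x)\<close>.\<close>
  have "(\<lambda>i. LINT x|lborel. norm (f x - s i x)) \<longlonglongrightarrow> (LINT x::real|lborel. 0::real)"
  proof (rule integral_dominated_convergence[where w="\<lambda>x. 3 * norm (f x)"])
    show "AE x in lborel. (\<lambda>i. norm (f x - s i x)) \<longlonglongrightarrow> 0"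
      using lim.hyps(2) by (auto intro!: AE_I2 tendsto_eq_intros)
    show "AE x in lborel. norm (norm (f x - s i x)) \<le> 3 * norm (f x)" for i
    proof (rule AE_I2)
      fix x
      show "norm (norm (f x - s i x)) \<le> 3 * norm (f x)"
        using norm_triangle_ineq4[of "f x" "s i x"] lim.hyps(3)[of x i] by simp
    qed
    show "integrable lborel (\<lambda>x. 3 * norm (f x))" using lim.hyps(4) by simp
  qed auto
  then have ev: "eventually (\<lambda>i. (LINT x|lborel. norm (f x - s i x)) < e) sequentially" if "e > 0" for e
    using order_tendstoD(2)[of _ 0 sequentially e] that by simp
  show ?case
  proof (rule translate_tendsto_0_approx[OF lim.hyps(4)])
    fix e :: real assume "e > 0"
    from eventually_happens[OF ev[OF this]]
    obtain i where "(LINT x|lborel. norm (f x - s i x)) < e" by auto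
    then show "\<exists>g. integrable lborel g \<and> (LINT x|lborel. norm (f x - g x)) < e \<and>
        ((\<lambda>h. LINT x|lborel. norm (g (x + h) - g x)) \<longlongrightarrow> 0) (at 0)"
      using lim.hyps(1) lim.IH by (intro exI[of _ "s i"]) auto
  qed
qed

section \<open>Plancherel's theorem\<close>

definition ft :: "(real \<Rightarrow> complex) \<Rightarrow> real \<Rightarrow> complex" where
  "ft g \<xi> = (LINT x|lborel. cis (- 2 * pi * x * \<xi>) * g x)"

text \<open>Both sides of Plancherel are read off this one function: its transform is the squared
  modulus of \<open>ft g\<close>, and its value at 0 is the squared L2 norm of \<open>g\<close>.
  Where the product is not integrable, the value is 0 by convention.\<close>

definition autocorr :: "(real \<Rightarrow> complex) \<Rightarrow> real \<Rightarrow> complex" where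
  "autocorr g t = (LINT y|lborel. g (y + t) * cnj (g y))"

lemma borel_measurable_cis [measurable]: "cis \<in> borel_measurable borel"
  by (intro borel_measurable_continuous_onI) (auto intro!: continuous_intros)

lemma borel_measurable_cnj [measurable]: "cnj \<in> borel_measurable borel"
  by (intro borel_measurable_continuous_onI) (auto intro!: continuous_intros)

lemma borel_measurable_ft [measurable]:
  assumes [measurable]: "g \<in> borel_measurable borel"
  shows "ft g \<in> borel_measurable borel"
  unfolding ft_def by measurable

lemma integrable_cis_mult:
  assumes "integrable lborel g"
  shows "integrable lborel (\<lambda>x. cis (a * x * b) * g x)"
proof -
  have [measurable]: "g \<in> borel_measurable borel" using assms by auto
  show ?thesis
    by (rule Bochner_Integration.integrable_bound[OF assms]) (auto simp: norm_mult)
qed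

lemma norm_ft_le:
  shows "norm (ft g \<xi>) \<le> (LINT x|lborel. norm (g x))"
  unfolding ft_def using integral_norm_bound[of lborel "\<lambda>x. cis (- 2 * pi * x * \<xi>) * g x"]
  by (simp add: norm_mult)

text \<open>Fubini, because the kernel is symmetric in \<open>x\<close> and \<xi>. The formula does
  the work of an inversion theorem: once with a Gaussian as \<open>k\<close>, once for the cross
  term in \<open>is_fourier_inverse\<close>.\<close>

lemma ft_mult_integral:
  assumes h: "integrable lborel h" and k: "integrable lborel k"
  shows "(LINT \<xi>|lborel. ft h \<xi> * k \<xi>) = (LINT x|lborel. h x * ft k x)"
proof -
  have [measurable]: "h \<in> borel_measurable borel" "k \<in> borel_measurable borel" using h k by auto
  define F where "F = (\<lambda>x \<xi>. cis (- 2 * pi * x * \<xi>) * h x * k \<xi>)"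
  have int: "integrable (lborel \<Otimes>\<^sub>M lborel) (case_prod F)"
  proof (rule lborel_pair.Fubini_integrable)
    show "case_prod F \<in> borel_measurable (lborel \<Otimes>\<^sub>M lborel)"
      unfolding F_def by measurable
    show "integrable lborel (\<lambda>x. LINT y|lborel. norm (case_prod F (x, y)))"
      using h k by (simp add: F_def norm_mult)
    have "integrable lborel (\<lambda>y. F x y)" for x
      using integrable_mult_right[OF integrable_cis_mult[OF k, of "- 2 * pi" x], of "h x"]
      by (simp add: F_def mult_ac)
    then show "AE x in lborel. integrable lborel (\<lambda>y. case_prod F (x, y))" by simp
  qed
  have "(LINT \<xi>|lborel. ft h \<xi> * k \<xi>) = (LINT \<xi>|lborel. LINT x|lborel. F x \<xi>)"
    unfolding ft_def F_def using integrable_cis_mult[OF h, of "- 2 * pi"] by simp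
  also have "\<dots> = (LINT x|lborel. LINT \<xi>|lborel. F x \<xi>)"
    by (rule lborel_pair.Fubini_integral[OF int])
  also have "(\<lambda>x. LINT \<xi>|lborel. F x \<xi>) = (\<lambda>x. h x * ft k x)"
  proof
    fix x
    have "(LINT \<xi>|lborel. F x \<xi>) = (LINT \<xi>|lborel. h x * (cis (- 2 * pi * \<xi> * x) * k \<xi>))"
      by (simp add: F_def mult_ac)
    also have "\<dots> = h x * ft k x" unfolding ft_def by simp
    finally show "(LINT \<xi>|lborel. F x \<xi>) = h x * ft k x" .
  qed
  finally show ?thesis .
qed

text \<open>Fubini in the pair \<open>(y, t)\<close>: the character splits as
  \<open>cis (- 2 * pi * (t + y) * \<xi>)\<close> times the conjugate of
  \<open>cis (- 2 * pi * y * \<xi>)\<close>, and translation invariance decouples the two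
  integrals.\<close>

lemma autocorr_ft:
  assumes g: "integrable lborel g"
  shows integrable_autocorr: "integrable lborel (autocorr g)"
    and ft_autocorr: "ft (autocorr g) \<xi> = complex_of_real ((cmod (ft g \<xi>))\<^sup>2)"
proof -
  have [measurable]: "g \<in> borel_measurable borel" using g by auto
  note T = integrable_translate[OF g]
  have int: "integrable (lborel \<Otimes>\<^sub>M lborel) (\<lambda>(y, t). cis (- 2 * pi * t * \<xi>) * (g (y + t) * cnj (g y)))" (is "integrable _ (case_prod ?F)") for \<xi>
  proof (rule lborel_pair.Fubini_integrable)
    show "case_prod ?F \<in> borel_measurable (lborel \<Otimes>\<^sub>M lborel)" by measurable
    have "(LINT t|lborel. norm (g (y + t))) = (LINT t|lborel. norm (g t))" for y
      using integral_translate[of "\<lambda>t. norm (g t)" y] by (simp add: add.commute)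
    then show "integrable lborel (\<lambda>y. LINT t|lborel. norm (case_prod ?F (y, t)))"
      using g by (simp add: norm_mult)
    have "integrable lborel (\<lambda>t. ?F y t)" for y
      using integrable_cis_mult[of "\<lambda>t. g (y + t) * cnj (g y)" "- 2 * pi" \<xi>] T[of y]
      by (simp add: add.commute)
    then show "AE y in lborel. integrable lborel (\<lambda>t. case_prod ?F (y, t))" by simp
  qed
  \<comment> \<open>The case \<xi> = 0 of the joint integrability, where the character is 1.\<close>
  have "integrable lborel (\<lambda>t. LINT y|lborel. g (y + t) * cnj (g y))"
    using lborel_pair.integrable_snd[OF int[of 0]] by simp
  then show C: "integrable lborel (autocorr g)" by (simp add: autocorr_def[abs_def])
  have inner: "(LINT t|lborel. cis (- 2 * pi * t * \<xi>) * (g (y + t) * cnj (g y))) = ft g \<xi> * cnj (cis (- 2 * pi * y * \<xi>) * g y)" for y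
  proof -
    have "cis (- 2 * pi * t * \<xi>) * (g (y + t) * cnj (g y))
        = cis (- 2 * pi * (t + y) * \<xi>) * g (t + y) * cnj (cis (- 2 * pi * y * \<xi>) * g y)" for t
    proof -
      have "cis (- 2 * pi * t * \<xi>) = cis (- 2 * pi * (t + y) * \<xi>) * cis (2 * pi * y * \<xi>)"
        by (simp add: cis_mult algebra_simps)
      then show ?thesis by (simp add: cis_cnj mult_ac add.commute)
    qed
    then have "(LINT t|lborel. cis (- 2 * pi * t * \<xi>) * (g (y + t) * cnj (g y)))
        = (LINT t|lborel. cis (- 2 * pi * (t + y) * \<xi>) * g (t + y)) * cnj (cis (- 2 * pi * y * \<xi>) * g y)"
      by (simp only: integral_mult_left_zero)
    also have "(LINT t|lborel. cis (- 2 * pi * (t + y) * \<xi>) * g (t + y)) = ft g \<xi>"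
      unfolding ft_def by (rule integral_translate[of "\<lambda>t. cis (- 2 * pi * t * \<xi>) * g t"])
    finally show ?thesis .
  qed
  have "ft (autocorr g) \<xi> = (LINT t|lborel. LINT y|lborel. cis (- 2 * pi * t * \<xi>) * (g (y + t) * cnj (g y)))"
    unfolding ft_def autocorr_def by (simp only: integral_mult_right_zero)
  also have "\<dots> = (LINT y|lborel. LINT t|lborel. cis (- 2 * pi * t * \<xi>) * (g (y + t) * cnj (g y)))"
    by (rule lborel_pair.Fubini_integral[OF int])
  also have "\<dots> = ft g \<xi> * (LINT y|lborel. cnj (cis (- 2 * pi * y * \<xi>) * g y))"
    by (simp only: inner integral_mult_right_zero)
  also have "\<dots> = ft g \<xi> * cnj (ft g \<xi>)"
    unfolding ft_def by (subst Bochner_Integration.integral_cnj) simp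
  finally show "ft (autocorr g) \<xi> = complex_of_real ((cmod (ft g \<xi>))\<^sup>2)"
    by (simp only: complex_norm_square)
qed

section \<open>Gaussian weights and Plancherel for bounded functions\<close>

lemma integral_std_normal_cis:
  "(LINT x|lborel. std_normal_density x *\<^sub>R cis (\<tau> * x)) = complex_of_real (exp (- (\<tau>\<^sup>2) / 2))"
proof -
  have "complex_of_real (exp (- (\<tau>\<^sup>2) / 2)) = (CLINT x|std_normal_distribution. iexp (\<tau> * x))"
    using char_std_normal_distribution by (simp add: char_def fun_eq_iff)
  also have "\<dots> = (LINT x|lborel. std_normal_density x *\<^sub>R cis (\<tau> * x))"
    by (subst integral_density) (auto simp: cis_conv_exp)
  finally show ?thesis by simp
qed

lemma integrable_gauss:
  assumes "a > 0"
  shows "integrable lborel (\<lambda>x. exp (- (a * x)\<^sup>2 / 2) :: real)"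
proof -
  have "integrable lborel (\<lambda>x. sqrt (2 * pi) * std_normal_density (0 + a * x))"
    using lborel_integrable_real_affine[OF integrable_normal_density[of 1 0], of a 0] assms by simp
  then show ?thesis by (simp add: std_normal_density_def)
qed

text \<open>The substitution \<open>x = 2 * pi * d * \<xi>\<close> in the characteristic function of
  the standard normal law. The result is the normal density of standard deviation \<open>d\<close>,
  an approximate identity as \<open>d\<close> tends to 0.\<close>

lemma ft_gauss:
  assumes d: "d > 0"
  shows "ft (\<lambda>\<xi>. complex_of_real (exp (- (2 * pi * d * \<xi>)\<^sup>2 / 2))) t = complex_of_real (std_normal_density (t / d) / d)"
proof -
  have "complex_of_real (exp (- ((- t / d)\<^sup>2) / 2)) = (LINT x|lborel. std_normal_density x *\<^sub>R cis ((- t / d) * x))"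
    by (rule integral_std_normal_cis[symmetric])
  also have "\<dots> = \<bar>2 * pi * d\<bar> *\<^sub>R (LINT x|lborel. std_normal_density (0 + (2 * pi * d) * x) *\<^sub>R cis ((- t / d) * (0 + (2 * pi * d) * x)))"
    using d by (intro lborel_integral_real_affine) simp
  also have "(\<lambda>x. std_normal_density (0 + (2 * pi * d) * x) *\<^sub>R cis ((- t / d) * (0 + (2 * pi * d) * x)))
      = (\<lambda>x. complex_of_real (1 / sqrt (2 * pi)) * (cis (- 2 * pi * x * t) * complex_of_real (exp (- (2 * pi * d * x)\<^sup>2 / 2))))"
    using d by (auto simp: std_normal_density_def scaleR_conv_of_real field_simps)
  also have "(LINT x|lborel. complex_of_real (1 / sqrt (2 * pi)) * (cis (- 2 * pi * x * t) * complex_of_real (exp (- (2 * pi * d * x)\<^sup>2 / 2))))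
      = complex_of_real (1 / sqrt (2 * pi)) * ft (\<lambda>\<xi>. complex_of_real (exp (- (2 * pi * d * \<xi>)\<^sup>2 / 2))) t"
    unfolding ft_def by (simp only: integral_mult_right_zero)
  finally have "complex_of_real (exp (- ((t / d)\<^sup>2) / 2))
      = complex_of_real (sqrt (2 * pi) * d) * ft (\<lambda>\<xi>. complex_of_real (exp (- (2 * pi * d * \<xi>)\<^sup>2 / 2))) t"
    using d real_div_sqrt[of "2 * pi"]
    by (simp add: scaleR_conv_of_real times_divide_eq_left[symmetric] del: times_divide_eq_left flip: mult.assoc of_real_mult of_real_divide)
  then have "ft (\<lambda>\<xi>. complex_of_real (exp (- (2 * pi * d * \<xi>)\<^sup>2 / 2))) t
     = complex_of_real (exp (- ((t / d)\<^sup>2) / 2)) / complex_of_real (sqrt (2 * pi) * d)"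
    using d by (simp add: field_simps)
  also have "\<dots> = complex_of_real (std_normal_density (t / d) / d)"
    by (simp add: std_normal_density_def)
  finally show ?thesis .
qed

text \<open>Boundedness of one factor leaves the other to be measured in L1. The autocorrelation is
  then bounded everywhere, and its continuity at 0 is inherited from the continuity of
  translations.\<close>

lemma autocorr_bounds:
  assumes g: "integrable lborel g" and B: "\<And>x. norm (g x) \<le> B"
  shows norm_autocorr_le: "norm (autocorr g t) \<le> B * (LINT x|lborel. norm (g x))"
    and autocorr_diff_le: "norm (autocorr g t - autocorr g 0) \<le> B * (LINT x|lborel. norm (g (x + t) - g x))"
proof -
  have [measurable]: "g \<in> borel_measurable borel" using g by auto
  have B0: "B \<ge> 0" using B[of 0] norm_ge_zero order_trans by blast
  note T = integrable_translate[OF g]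
  have int: "integrable lborel (\<lambda>y. h y * cnj (g y))" if h: "integrable lborel h" for h
  proof (rule Bochner_Integration.integrable_bound[of _ "\<lambda>y. B *\<^sub>R h y"])
    show "AE x in lborel. cmod (h x * cnj (g x)) \<le> cmod (B *\<^sub>R h x)"
      using B0 B by (auto intro!: AE_I2 mult_right_mono simp: norm_mult mult.commute)
    have [measurable]: "h \<in> borel_measurable borel" using h by auto
    show "(\<lambda>y. h y * cnj (g y)) \<in> borel_measurable lborel" by measurable
  qed (use h in auto)
  have bd: "norm (LINT y|lborel. h y * cnj (g y)) \<le> B * (LINT y|lborel. norm (h y))" if h: "integrable lborel h" for h
  proof -
    have "norm (LINT y|lborel. h y * cnj (g y)) \<le> (LINT y|lborel. norm (h y * cnj (g y)))"
      by (rule integral_norm_bound)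
    also have "\<dots> \<le> (LINT y|lborel. B * norm (h y))"
      using B0 B h integrable_norm[OF int[OF h]] by (intro integral_mono) (auto intro!: mult_right_mono simp: norm_mult mult.commute)
    finally show ?thesis by simp
  qed
  show "norm (autocorr g t) \<le> B * (LINT x|lborel. norm (g x))"
    using bd[OF T[of t]] integral_translate[of "\<lambda>x. norm (g x)" t] by (simp add: autocorr_def)
  have "autocorr g t - autocorr g 0 = (LINT y|lborel. (g (y + t) - g y) * cnj (g y))"
    using int[OF T[of t]] int[OF g] by (simp add: autocorr_def left_diff_distrib)
  then show "norm (autocorr g t - autocorr g 0) \<le> B * (LINT x|lborel. norm (g (x + t) - g x))"
    using bd[of "\<lambda>y. g (y + t) - g y"] T[of t] g by simp
qed

text \<open>The multiplication formula for the autocorrelation and a Gaussian. After the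
  substitution \<open>t = d * z\<close> the density no longer depends on \<open>d\<close>, so that a
  single majorant serves the limit.\<close>

lemma gauss_weighted_ft:
  assumes g: "integrable lborel g" and d: "d > 0"
  shows "complex_of_real (LINT \<xi>|lborel. (cmod (ft g \<xi>))\<^sup>2 * exp (- (2 * pi * d * \<xi>)\<^sup>2 / 2))
    = (LINT z|lborel. autocorr g (d * z) * complex_of_real (std_normal_density z))"
proof -
  have gi: "integrable lborel (\<lambda>\<xi>. complex_of_real (exp (- (2 * pi * d * \<xi>)\<^sup>2 / 2)))"
    using integrable_gauss[of "2 * pi * d"] d by simp
  have "complex_of_real (LINT \<xi>|lborel. (cmod (ft g \<xi>))\<^sup>2 * exp (- (2 * pi * d * \<xi>)\<^sup>2 / 2))
     = (LINT \<xi>|lborel. ft (autocorr g) \<xi> * complex_of_real (exp (- (2 * pi * d * \<xi>)\<^sup>2 / 2)))"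
    by (simp add: ft_autocorr[OF g] flip: integral_complex_of_real)
  also have "\<dots> = (LINT t|lborel. autocorr g t * complex_of_real (std_normal_density (t / d) / d))"
    by (simp only: ft_mult_integral[OF integrable_autocorr[OF g] gi] ft_gauss[OF d])
  also have "\<dots> = \<bar>d\<bar> *\<^sub>R (LINT z|lborel. autocorr g (0 + d * z) * complex_of_real (std_normal_density ((0 + d * z) / d) / d))"
    using d by (intro lborel_integral_real_affine) simp
  also have "\<dots> = (LINT z|lborel. autocorr g (d * z) * complex_of_real (std_normal_density z))"
    using d by (simp flip: integral_scaleR_right add: scaleR_conv_of_real)
  finally show ?thesis .
qed

text \<open>As \<open>d\<close> decreases to 0, the Gaussian weights increase to 1, while the right
  side of \<open>gauss_weighted_ft\<close> tends to \<open>autocorr g 0\<close> by dominated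
  convergence. Monotone convergence on the left then yields integrability and the value at
  once.\<close>

lemma plancherel_bounded:
  assumes g: "integrable lborel g" and B: "\<And>x. norm (g x) \<le> B"
  shows "integrable lborel (\<lambda>\<xi>. (cmod (ft g \<xi>))\<^sup>2)"
    and "(LINT \<xi>|lborel. (cmod (ft g \<xi>))\<^sup>2) = (LINT x|lborel. (cmod (g x))\<^sup>2)"
proof -
  have [measurable]: "g \<in> borel_measurable borel" using g by auto
  have [measurable]: "autocorr g \<in> borel_measurable borel" using integrable_autocorr[OF g] by auto
  define d where "d = (\<lambda>n. 1 / real (Suc n))"
  have d: "d n > 0" for n by (simp add: d_def)
  have d0: "d \<longlonglongrightarrow> 0" unfolding d_def by (rule LIMSEQ_Suc[OF lim_1_over_n])
  have ac: "(autocorr g \<longlongrightarrow> autocorr g 0) (at 0)"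
  proof (rule LIM_zero_cancel, rule Lim_null_comparison)
    show "\<forall>\<^sub>F t in at 0. norm (autocorr g t - autocorr g 0) \<le> B * (LINT x|lborel. norm (g (x + t) - g x))"
      using autocorr_diff_le[OF g B] by simp
    show "((\<lambda>t. B * (LINT x|lborel. norm (g (x + t) - g x))) \<longlongrightarrow> 0) (at 0)"
      using tendsto_mult_left[OF translate_tendsto_0[OF g], of B] by simp
  qed
  then have ic: "isCont (autocorr g) 0" by (simp add: isCont_def)
  have lim: "(\<lambda>n. LINT z|lborel. autocorr g (d n * z) * complex_of_real (std_normal_density z))
      \<longlonglongrightarrow> (LINT z|lborel. autocorr g 0 * complex_of_real (std_normal_density z))"
  proof (rule integral_dominated_convergence[where w="\<lambda>z. (B * (LINT x|lborel. norm (g x))) * std_normal_density z"])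
    show "AE z in lborel. (\<lambda>n. autocorr g (d n * z) * complex_of_real (std_normal_density z))
        \<longlonglongrightarrow> autocorr g 0 * complex_of_real (std_normal_density z)"
    proof (rule AE_I2)
      fix z
      have "(\<lambda>n. d n * z) \<longlonglongrightarrow> 0" using tendsto_mult_right[OF d0, of z] by simp
      from isCont_tendsto_compose[OF ic this]
      show "(\<lambda>n. autocorr g (d n * z) * complex_of_real (std_normal_density z))
        \<longlonglongrightarrow> autocorr g 0 * complex_of_real (std_normal_density z)"
        by (intro tendsto_intros)
    qed
    show "AE z in lborel. norm (autocorr g (d n * z) * complex_of_real (std_normal_density z))
        \<le> B * (LINT x|lborel. norm (g x)) * std_normal_density z" for n
      using norm_autocorr_le[OF g B] by (auto intro!: AE_I2 mult_right_mono simp: norm_mult)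
  qed auto
  have ac0: "autocorr g 0 = complex_of_real (LINT x|lborel. (cmod (g x))\<^sup>2)"
    unfolding autocorr_def by (simp flip: integral_complex_of_real add: complex_norm_square del: of_real_power)
  have "(LINT z|lborel. autocorr g 0 * complex_of_real (std_normal_density z)) = complex_of_real (LINT x|lborel. (cmod (g x))\<^sup>2)"
    by (simp add: ac0)
  with lim have "(\<lambda>n. complex_of_real (LINT \<xi>|lborel. (cmod (ft g \<xi>))\<^sup>2 * exp (- (2 * pi * d n * \<xi>)\<^sup>2 / 2)))
      \<longlonglongrightarrow> complex_of_real (LINT x|lborel. (cmod (g x))\<^sup>2)"
    by (simp only: gauss_weighted_ft[OF g d])
  then have lim': "(\<lambda>n. LINT \<xi>|lborel. (cmod (ft g \<xi>))\<^sup>2 * exp (- (2 * pi * d n * \<xi>)\<^sup>2 / 2))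
      \<longlonglongrightarrow> (LINT x|lborel. (cmod (g x))\<^sup>2)"
    by (simp only: tendsto_of_real_iff)
  have int: "integrable lborel (\<lambda>\<xi>. (cmod (ft g \<xi>))\<^sup>2 * exp (- (2 * pi * d n * \<xi>)\<^sup>2 / 2))" for n
  proof (rule Bochner_Integration.integrable_bound)
    show "integrable lborel (\<lambda>\<xi>. (LINT x|lborel. norm (g x))\<^sup>2 * exp (- (2 * pi * d n * \<xi>)\<^sup>2 / 2))"
      using integrable_gauss[of "2 * pi * d n"] d by simp
    show "AE \<xi> in lborel. norm ((cmod (ft g \<xi>))\<^sup>2 * exp (- (2 * pi * d n * \<xi>)\<^sup>2 / 2))
      \<le> norm ((LINT x|lborel. norm (g x))\<^sup>2 * exp (- (2 * pi * d n * \<xi>)\<^sup>2 / 2))"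
      using norm_ft_le[of g] by (auto intro!: AE_I2 mult_right_mono power_mono simp: abs_mult)
  qed auto
  have mono: "AE \<xi> in lborel. mono (\<lambda>n. (cmod (ft g \<xi>))\<^sup>2 * exp (- (2 * pi * d n * \<xi>)\<^sup>2 / 2))"
  proof (rule AE_I2, rule monoI)
    fix \<xi> and m n :: nat assume "m \<le> n"
    then have "d n \<le> d m" by (simp add: d_def frac_le)
    then have "(d n)\<^sup>2 * (2 * pi * \<xi>)\<^sup>2 \<le> (d m)\<^sup>2 * (2 * pi * \<xi>)\<^sup>2"
      using d[of n] by (intro mult_right_mono power_mono) auto
    then show "(cmod (ft g \<xi>))\<^sup>2 * exp (- (2 * pi * d m * \<xi>)\<^sup>2 / 2) \<le> (cmod (ft g \<xi>))\<^sup>2 * exp (- (2 * pi * d n * \<xi>)\<^sup>2 / 2)"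
      by (intro mult_left_mono) (auto simp: power_mult_distrib mult_ac)
  qed
  have ptw: "AE \<xi> in lborel. (\<lambda>n. (cmod (ft g \<xi>))\<^sup>2 * exp (- (2 * pi * d n * \<xi>)\<^sup>2 / 2)) \<longlonglongrightarrow> (cmod (ft g \<xi>))\<^sup>2"
    by (rule AE_I2) (auto intro!: tendsto_eq_intros d0)
  show "integrable lborel (\<lambda>\<xi>. (cmod (ft g \<xi>))\<^sup>2)"
    and "(LINT \<xi>|lborel. (cmod (ft g \<xi>))\<^sup>2) = (LINT x|lborel. (cmod (g x))\<^sup>2)"
    using integrable_monotone_convergence[OF int mono ptw lim'] integral_monotone_convergence[OF int mono ptw lim']
    by auto
qed

section \<open>From bounded functions to L1 and L2: limits of squared norms\<close>

lemma nn_integral_norm_square_le: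
  fixes F G :: "'a \<Rightarrow> complex"
  assumes [measurable]: "F \<in> borel_measurable M" "G \<in> borel_measurable M" and \<eta>: "\<eta> > 0"
  shows "(\<integral>\<^sup>+ x. ennreal ((cmod (F x))\<^sup>2) \<partial>M)
    \<le> ennreal (1 + \<eta>) * (\<integral>\<^sup>+ x. ennreal ((cmod (G x))\<^sup>2) \<partial>M)
      + ennreal (1 + 1 / \<eta>) * (\<integral>\<^sup>+ x. ennreal ((cmod (F x - G x))\<^sup>2) \<partial>M)"
proof -
  have *: "(cmod (F x))\<^sup>2 \<le> (1 + \<eta>) * (cmod (G x))\<^sup>2 + (1 + 1 / \<eta>) * (cmod (F x - G x))\<^sup>2" for x
  proof -
    define a b where "a = cmod (G x)" and "b = cmod (F x - G x)"
    have "cmod (F x) \<le> a + b"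
      unfolding a_def b_def using norm_triangle_ineq[of "G x" "F x - G x"] by simp
    then have "(cmod (F x))\<^sup>2 \<le> (a + b)\<^sup>2" by (intro power_mono) auto
    also have "\<dots> \<le> (1 + \<eta>) * a\<^sup>2 + (1 + 1 / \<eta>) * b\<^sup>2"
    proof -
      \<comment> \<open>The parameter splits the cross term unevenly: \<open>2 * a * b\<close> is at
        most \<open>\<eta> * a\<^sup>2 + b\<^sup>2 / \<eta>\<close>, so that the main term keeps a
        factor close to 1.\<close>
      have "0 \<le> (\<eta> * a - b)\<^sup>2 / \<eta>" using \<eta> by simp
      also have "\<dots> = \<eta> * a\<^sup>2 - 2 * a * b + b\<^sup>2 / \<eta>"
        using \<eta> by (simp add: power2_eq_square field_simps)
      finally show ?thesis by (simp add: power2_eq_square algebra_simps)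
    qed
    finally show ?thesis by (simp add: a_def b_def)
  qed
  have "(\<integral>\<^sup>+ x. ennreal ((cmod (F x))\<^sup>2) \<partial>M)
    \<le> (\<integral>\<^sup>+ x. ennreal (1 + \<eta>) * ennreal ((cmod (G x))\<^sup>2) + ennreal (1 + 1 / \<eta>) * ennreal ((cmod (F x - G x))\<^sup>2) \<partial>M)"
    using \<eta> * by (intro nn_integral_mono) (simp flip: ennreal_mult ennreal_plus)
  also have "\<dots> = ennreal (1 + \<eta>) * (\<integral>\<^sup>+ x. ennreal ((cmod (G x))\<^sup>2) \<partial>M)
      + ennreal (1 + 1 / \<eta>) * (\<integral>\<^sup>+ x. ennreal ((cmod (F x - G x))\<^sup>2) \<partial>M)"
    by (simp add: nn_integral_add nn_integral_cmult)
  finally show ?thesis .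
qed

text \<open>Sends the parameter of \<open>nn_integral_norm_square_le\<close> to 0. Sharp comparisons
  of squared norms are thus obtained without square roots or subtraction in
  \<open>ennreal\<close>.\<close>

lemma ennreal_le_mult_one_plus:
  fixes x y :: ennreal
  assumes "\<And>\<eta>. \<eta> > 0 \<Longrightarrow> x \<le> ennreal (1 + \<eta>) * y"
  shows "x \<le> y"
proof (cases "y = top")
  case False
  have "(\<lambda>n. ennreal (1 + 1 / real (Suc n))) \<longlonglongrightarrow> ennreal (1 + 0)"
    by (intro tendsto_ennrealI tendsto_add tendsto_const LIMSEQ_Suc[OF lim_1_over_n])
  then have "(\<lambda>n. ennreal (1 + 1 / real (Suc n)) * y) \<longlonglongrightarrow> ennreal (1 + 0) * y"
    using False by (intro tendsto_mult_ennreal tendsto_const) auto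
  then have "(\<lambda>n. ennreal (1 + 1 / real (Suc n)) * y) \<longlonglongrightarrow> y" by simp
  then show ?thesis
    by (rule LIMSEQ_le_const) (use assms in auto)
qed simp

text \<open>Continuity of the squared L2 norm, with values in the extended half-line: each of the
  two inequalities holds up to a factor \<open>1 + \<eta>\<close>. The filter is general because
  value truncations run along \<open>sequentially\<close> and truncated Fourier integrals along
  \<open>at_top\<close>.\<close>

lemma nn_integral_norm_square_tendsto_unique:
  fixes f :: "'b \<Rightarrow> 'a \<Rightarrow> complex"
  assumes "F \<noteq> bot" and [measurable]: "\<And>n. f n \<in> borel_measurable M" "U \<in> borel_measurable M"
    and D: "((\<lambda>n. \<integral>\<^sup>+ x. ennreal ((cmod (f n x - U x))\<^sup>2) \<partial>M) \<longlongrightarrow> 0) F"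
    and A: "((\<lambda>n. \<integral>\<^sup>+ x. ennreal ((cmod (f n x))\<^sup>2) \<partial>M) \<longlongrightarrow> c) F"
  shows "(\<integral>\<^sup>+ x. ennreal ((cmod (U x))\<^sup>2) \<partial>M) = c"
proof (rule antisym; rule ennreal_le_mult_one_plus)
  fix \<eta> :: real assume \<eta>: "\<eta> > 0"
  let ?D = "\<lambda>n. \<integral>\<^sup>+ x. ennreal ((cmod (f n x - U x))\<^sup>2) \<partial>M"
  let ?A = "\<lambda>n. \<integral>\<^sup>+ x. ennreal ((cmod (f n x))\<^sup>2) \<partial>M"
  let ?I = "\<integral>\<^sup>+ x. ennreal ((cmod (U x))\<^sup>2) \<partial>M"
  have D': "((\<lambda>n. ennreal (1 + 1 / \<eta>) * ?D n) \<longlongrightarrow> 0) F"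
    using ennreal_tendsto_cmult[OF _ D, of "ennreal (1 + 1 / \<eta>)"] by simp
  have "((\<lambda>n. ennreal (1 + \<eta>) * ?A n + ennreal (1 + 1 / \<eta>) * ?D n) \<longlongrightarrow> ennreal (1 + \<eta>) * c + 0) F"
    by (intro tendsto_add ennreal_tendsto_cmult A D') simp
  then show "?I \<le> ennreal (1 + \<eta>) * c"
    using nn_integral_norm_square_le[of U M "f _", OF _ _ \<eta>]
    by (intro tendsto_lowerbound[OF _ _ assms(1)]) (auto simp: norm_minus_commute)
  have "((\<lambda>n. ennreal (1 + \<eta>) * ?I + ennreal (1 + 1 / \<eta>) * ?D n) \<longlongrightarrow> ennreal (1 + \<eta>) * ?I + 0) F"
    by (intro tendsto_add tendsto_const D')
  then show "c \<le> ennreal (1 + \<eta>) * ?I"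
    using nn_integral_norm_square_le[of "f _" M U, OF _ _ \<eta>]
    by (intro tendsto_le[OF assms(1) _ A]) (auto intro!: always_eventually)
qed

lemma ft_diff:
  assumes "integrable lborel g" "integrable lborel h"
  shows "ft (\<lambda>x. g x - h x) \<xi> = ft g \<xi> - ft h \<xi>"
  using integrable_cis_mult[OF assms(1), of "-2 * pi" \<xi>] integrable_cis_mult[OF assms(2), of "-2 * pi" \<xi>]
  by (simp add: ft_def right_diff_distrib)

text \<open>Provides the bounded approximants to which \<open>plancherel_bounded\<close> applies;
  they are dominated by \<open>g\<close>, hence converge to it in L1 and, when \<open>g\<close> is
  square integrable, in L2.\<close>

definition value_trunc :: "(real \<Rightarrow> complex) \<Rightarrow> nat \<Rightarrow> real \<Rightarrow> complex" where
  "value_trunc g n x = (if cmod (g x) \<le> real n then g x else 0)"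

lemma norm_value_trunc_le: "cmod (value_trunc g n x) \<le> cmod (g x)" "cmod (value_trunc g n x) \<le> real n"
  "cmod (g x - value_trunc g n x) \<le> cmod (g x)"
  by (auto simp: value_trunc_def)

lemma value_trunc_tendsto: "(\<lambda>n. value_trunc g n x) \<longlonglongrightarrow> g x"
proof (rule tendsto_eventually)
  show "eventually (\<lambda>n. value_trunc g n x = g x) sequentially"
    by (rule eventually_sequentiallyI[of "nat \<lceil>cmod (g x)\<rceil>"]) (auto simp: value_trunc_def nat_le_iff ceiling_le_iff)
qed

lemma borel_measurable_value_trunc [measurable]:
  assumes [measurable]: "g \<in> borel_measurable borel"
  shows "value_trunc g n \<in> borel_measurable borel"
  unfolding value_trunc_def[abs_def] by measurable

lemma integrable_value_trunc:
  assumes "integrable lborel g"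
  shows "integrable lborel (value_trunc g n)"
proof -
  have [measurable]: "g \<in> borel_measurable borel" using assms by auto
  show ?thesis
    by (rule Bochner_Integration.integrable_bound[OF assms]) (auto simp: norm_value_trunc_le)
qed

lemma ft_value_trunc_norm_square:
  assumes g: "integrable lborel g"
  shows "(\<integral>\<^sup>+ \<xi>. ennreal ((cmod (ft (value_trunc g n) \<xi>))\<^sup>2) \<partial>lborel) = (\<integral>\<^sup>+ x. ennreal ((cmod (value_trunc g n x))\<^sup>2) \<partial>lborel)"
proof -
  have [measurable]: "g \<in> borel_measurable borel" using g by auto
  note P = plancherel_bounded[OF integrable_value_trunc[OF g, of n] norm_value_trunc_le(2)]
  have "integrable lborel (\<lambda>x. (cmod (value_trunc g n x))\<^sup>2)"
  proof (rule Bochner_Integration.integrable_bound)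
    show "integrable lborel (\<lambda>x. real n * cmod (g x))" using g by simp
    have "(cmod (value_trunc g n x))\<^sup>2 \<le> real n * cmod (g x)" for x
      unfolding power2_eq_square by (intro mult_mono norm_value_trunc_le) auto
    then show "AE x in lborel. norm ((cmod (value_trunc g n x))\<^sup>2) \<le> norm (real n * cmod (g x))" by simp
  qed measurable
  then show ?thesis using P by (simp add: nn_integral_eq_integral)
qed

text \<open>Transforms of the value truncations converge pointwise, so Fatou's lemma gives one
  inequality of Plancherel. Its purpose is to be applied to the error
  \<open>g - value_trunc g n\<close>.\<close>

lemma bessel_ft:
  assumes g: "integrable lborel g"
  shows "(\<integral>\<^sup>+ \<xi>. ennreal ((cmod (ft g \<xi>))\<^sup>2) \<partial>lborel) \<le> (\<integral>\<^sup>+ x. ennreal ((cmod (g x))\<^sup>2) \<partial>lborel)"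
proof -
  have [measurable]: "g \<in> borel_measurable borel" using g by auto
  have lim: "(\<lambda>n. ft (value_trunc g n) \<xi>) \<longlonglongrightarrow> ft g \<xi>" for \<xi>
    unfolding ft_def
  proof (rule integral_dominated_convergence[where w="\<lambda>x. cmod (g x)"])
    show "AE x in lborel. (\<lambda>n. cis (- 2 * pi * x * \<xi>) * value_trunc g n x) \<longlonglongrightarrow> cis (- 2 * pi * x * \<xi>) * g x"
      by (intro AE_I2 tendsto_intros value_trunc_tendsto)
  qed (use g in \<open>auto simp: norm_mult norm_value_trunc_le\<close>)
  have "(\<integral>\<^sup>+ \<xi>. ennreal ((cmod (ft g \<xi>))\<^sup>2) \<partial>lborel) = (\<integral>\<^sup>+ \<xi>. liminf (\<lambda>n. ennreal ((cmod (ft (value_trunc g n) \<xi>))\<^sup>2)) \<partial>lborel)"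
    using lim by (intro nn_integral_cong lim_imp_Liminf[symmetric] tendsto_ennrealI tendsto_intros) auto
  also have "\<dots> \<le> liminf (\<lambda>n. \<integral>\<^sup>+ \<xi>. ennreal ((cmod (ft (value_trunc g n) \<xi>))\<^sup>2) \<partial>lborel)"
    by (rule nn_integral_liminf) measurable
  also have "\<dots> \<le> liminf (\<lambda>n::nat. \<integral>\<^sup>+ x. ennreal ((cmod (g x))\<^sup>2) \<partial>lborel)"
    by (intro Liminf_mono always_eventually allI)
      (auto simp: ft_value_trunc_norm_square[OF g] intro!: nn_integral_mono ennreal_leI power_mono norm_value_trunc_le)
  also have "\<dots> = (\<integral>\<^sup>+ x. ennreal ((cmod (g x))\<^sup>2) \<partial>lborel)" by (simp add: Liminf_const)
  finally show ?thesis .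
qed

text \<open>By \<open>bessel_ft\<close> for the truncation error, L2 convergence of the truncations
  entails L2 convergence of their transforms; the equality known for bounded functions then passes
  to the limit on both sides.\<close>

theorem plancherel_nn:
  assumes g: "integrable lborel g" and g2: "integrable lborel (\<lambda>x. (cmod (g x))\<^sup>2)"
  shows "(\<integral>\<^sup>+ \<xi>. ennreal ((cmod (ft g \<xi>))\<^sup>2) \<partial>lborel) = (\<integral>\<^sup>+ x. ennreal ((cmod (g x))\<^sup>2) \<partial>lborel)"
proof (rule nn_integral_norm_square_tendsto_unique)
  have [measurable]: "g \<in> borel_measurable borel" using g by auto
  have fin: "(\<integral>\<^sup>+ x. ennreal ((cmod (g x))\<^sup>2) \<partial>lborel) < \<infinity>"
    using g2 by (simp add: nn_integral_eq_integral)
  show "sequentially \<noteq> bot" by simp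
  show "ft (value_trunc g n) \<in> borel_measurable lborel" "ft g \<in> borel_measurable lborel" for n by measurable
  have D: "(\<lambda>n. \<integral>\<^sup>+ x. ennreal ((cmod (g x - value_trunc g n x))\<^sup>2) \<partial>lborel) \<longlonglongrightarrow> (\<integral>\<^sup>+ x. ennreal ((cmod (0::complex))\<^sup>2) \<partial>(lborel :: real measure))"
  proof (rule nn_integral_dominated_convergence[where w="\<lambda>x. ennreal ((cmod (g x))\<^sup>2)"])
    show "AE x in lborel. (\<lambda>n. ennreal ((cmod (g x - value_trunc g n x))\<^sup>2)) \<longlonglongrightarrow> ennreal ((cmod 0)\<^sup>2)"
    proof (rule AE_I2)
      fix x
      have "(\<lambda>n. g x - value_trunc g n x) \<longlonglongrightarrow> 0"
        using tendsto_diff[OF tendsto_const[of "g x"] value_trunc_tendsto[of g x]] by simp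
      then show "(\<lambda>n. ennreal ((cmod (g x - value_trunc g n x))\<^sup>2)) \<longlonglongrightarrow> ennreal ((cmod 0)\<^sup>2)"
        by (intro tendsto_ennrealI tendsto_power tendsto_norm)
    qed
  qed (use fin in \<open>auto intro!: ennreal_leI power_mono norm_value_trunc_le\<close>)
  show "(\<lambda>n. \<integral>\<^sup>+ \<xi>. ennreal ((cmod (ft (value_trunc g n) \<xi> - ft g \<xi>))\<^sup>2) \<partial>lborel) \<longlonglongrightarrow> 0"
  proof (rule tendsto_sandwich[OF _ _ tendsto_const])
    show "\<forall>\<^sub>F n in sequentially. (\<integral>\<^sup>+ \<xi>. ennreal ((cmod (ft (value_trunc g n) \<xi> - ft g \<xi>))\<^sup>2) \<partial>lborel)
        \<le> (\<integral>\<^sup>+ x. ennreal ((cmod (g x - value_trunc g n x))\<^sup>2) \<partial>lborel)"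
      using bessel_ft[of "\<lambda>x. g x - value_trunc g _ x"] g integrable_value_trunc[OF g]
      by (simp add: ft_diff norm_minus_commute)
    show "(\<lambda>n. \<integral>\<^sup>+ x. ennreal ((cmod (g x - value_trunc g n x))\<^sup>2) \<partial>lborel) \<longlonglongrightarrow> 0"
      using D by simp
  qed simp
  show "(\<lambda>n. \<integral>\<^sup>+ \<xi>. ennreal ((cmod (ft (value_trunc g n) \<xi>))\<^sup>2) \<partial>lborel) \<longlonglongrightarrow> (\<integral>\<^sup>+ x. ennreal ((cmod (g x))\<^sup>2) \<partial>lborel)"
    unfolding ft_value_trunc_norm_square[OF g]
  proof (rule nn_integral_dominated_convergence[where w="\<lambda>x. ennreal ((cmod (g x))\<^sup>2)"])
    show "AE x in lborel. (\<lambda>n. ennreal ((cmod (value_trunc g n x))\<^sup>2)) \<longlonglongrightarrow> ennreal ((cmod (g x))\<^sup>2)"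
      by (intro AE_I2 tendsto_ennrealI tendsto_intros value_trunc_tendsto)
  qed (use fin in \<open>auto intro!: ennreal_leI power_mono norm_value_trunc_le\<close>)
qed

theorem plancherel:
  assumes g: "integrable lborel g" and g2: "integrable lborel (\<lambda>x. (cmod (g x))\<^sup>2)"
  shows integrable_norm_ft_square: "integrable lborel (\<lambda>\<xi>. (cmod (ft g \<xi>))\<^sup>2)"
    and integral_norm_ft_square: "(LINT \<xi>|lborel. (cmod (ft g \<xi>))\<^sup>2) = (LINT x|lborel. (cmod (g x))\<^sup>2)"
proof -
  have [measurable]: "g \<in> borel_measurable borel" using g by auto
  have eq: "(\<integral>\<^sup>+ \<xi>. ennreal ((cmod (ft g \<xi>))\<^sup>2) \<partial>lborel) = ennreal (LINT x|lborel. (cmod (g x))\<^sup>2)"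
    unfolding plancherel_nn[OF g g2] by (rule nn_integral_eq_integral[OF g2]) simp
  show "integrable lborel (\<lambda>\<xi>. (cmod (ft g \<xi>))\<^sup>2)"
    by (rule integrableI_nn_integral_finite[OF _ _ eq]) auto
  show "(LINT \<xi>|lborel. (cmod (ft g \<xi>))\<^sup>2) = (LINT x|lborel. (cmod (g x))\<^sup>2)"
    by (rule integral_eq_nn_integral[THEN trans]) (auto simp: eq)
qed

section \<open>The L2 Fourier transform\<close>

definition space_trunc :: "(real \<Rightarrow> real) \<Rightarrow> real \<Rightarrow> real \<Rightarrow> complex" where
  "space_trunc u R x = complex_of_real (indicator {-R..R} x * u x)"

lemma borel_measurable_space_trunc [measurable]:
  assumes [measurable]: "u \<in> borel_measurable borel"
  shows "space_trunc u R \<in> borel_measurable borel"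
  unfolding space_trunc_def[abs_def] by measurable

lemma ft_trunc_eq_ft: "ft_trunc u R = ft (space_trunc u R)"
  unfolding ft_trunc_def ft_def set_lebesgue_integral_def space_trunc_def
  by (intro ext Bochner_Integration.integral_cong) (auto simp: indicator_def)

text \<open>On the bounded support of \<open>w\<close>, use that the norm of \<open>U x\<close> is
  at most one plus its square. It makes both space truncations and frequency cutoffs integrable, so
  that their transforms are ordinary integrals.\<close>

lemma integrable_if_square_integrable:
  fixes w :: "real \<Rightarrow> real" and U :: "real \<Rightarrow> 'a::{banach, second_countable_topology}"
  assumes [measurable]: "w \<in> borel_measurable borel" "U \<in> borel_measurable borel"
    and U: "integrable lborel (\<lambda>x. (norm (U x))\<^sup>2)"
    and w: "\<And>x. \<bar>w x\<bar> \<le> B" "\<And>x. \<bar>x\<bar> > N \<Longrightarrow> w x = 0"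
  shows "integrable lborel (\<lambda>x. w x *\<^sub>R U x)"
proof (rule Bochner_Integration.integrable_bound)
  have "integrable lborel (indicat_real {-N..N})"
    by (rule integrable_real_indicator) (auto simp: emeasure_lborel_Icc_eq)
  then show "integrable lborel (\<lambda>x. B * (indicat_real {-N..N} x + (norm (U x))\<^sup>2))"
    using U by (intro integrable_mult_right Bochner_Integration.integrable_add) auto
  show "AE x in lborel. norm (w x *\<^sub>R U x) \<le> norm (B * (indicat_real {-N..N} x + (norm (U x))\<^sup>2))"
  proof (rule AE_I2)
    fix x
    have B: "B \<ge> 0" using w(1)[of 0] by linarith
    show "norm (w x *\<^sub>R U x) \<le> norm (B * (indicat_real {-N..N} x + (norm (U x))\<^sup>2))"
    proof (cases "\<bar>x\<bar> > N")
      case True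
      then show ?thesis by (simp add: w(2))
    next
      case False
      then have i: "indicat_real {-N..N} x = 1" by (auto simp: indicator_def)
      have "2 * norm (U x) \<le> 1 + (norm (U x))\<^sup>2"
        using sum_squares_bound[of 1 "norm (U x)"] by simp
      then have "norm (U x) \<le> 1 + (norm (U x))\<^sup>2"
        using norm_ge_zero[of "U x"] by linarith
      then have "\<bar>w x\<bar> * norm (U x) \<le> B * (1 + (norm (U x))\<^sup>2)"
        using w(1)[of x] B by (intro mult_mono) auto
      then show ?thesis using B by (simp add: i abs_mult)
    qed
  qed
qed measurable

lemma space_trunc_integrable:
  assumes [measurable]: "u \<in> borel_measurable borel" and u: "integrable lborel (\<lambda>x. (u x)\<^sup>2)"
  shows integrable_space_trunc: "integrable lborel (space_trunc u R)"
    and integrable_space_trunc_square: "integrable lborel (\<lambda>x. (cmod (space_trunc u R x))\<^sup>2)"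
proof -
  have "integrable lborel (\<lambda>x. indicat_real {-R..R} x *\<^sub>R u x)"
    using u by (intro integrable_if_square_integrable[where B=1 and N=R]) (auto simp: indicator_def)
  then show "integrable lborel (space_trunc u R)" by (simp add: space_trunc_def[abs_def] del: of_real_mult)
  show "integrable lborel (\<lambda>x. (cmod (space_trunc u R x))\<^sup>2)"
    by (rule Bochner_Integration.integrable_bound[OF u]) (auto simp: space_trunc_def indicator_def)
qed

lemma borel_measurable_ft_trunc [measurable]:
  assumes [measurable]: "u \<in> borel_measurable borel"
  shows "ft_trunc u R \<in> borel_measurable borel"
  unfolding ft_trunc_eq_ft by measurable

lemma integral_space_trunc_tendsto:
  assumes [measurable]: "u \<in> borel_measurable borel" and u: "integrable lborel (\<lambda>x. (u x)\<^sup>2)"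
  shows "((\<lambda>R. LINT x|lborel. (cmod (space_trunc u R x))\<^sup>2) \<longlongrightarrow> (LINT x|lborel. (u x)\<^sup>2)) at_top"
proof (rule integral_dominated_convergence_at_top[where w="\<lambda>x. (u x)\<^sup>2"])
  show "AE x in lborel. ((\<lambda>R. (cmod (space_trunc u R x))\<^sup>2) \<longlongrightarrow> (u x)\<^sup>2) at_top"
  proof (rule AE_I2, rule tendsto_eventually)
    fix x :: real
    show "\<forall>\<^sub>F R in at_top. (cmod (space_trunc u R x))\<^sup>2 = (u x)\<^sup>2"
      using eventually_ge_at_top[of "\<bar>x\<bar>"]
      by eventually_elim (auto simp: space_trunc_def indicator_def)
  qed
qed (use u in \<open>auto simp: space_trunc_def indicator_def\<close>)

text \<open>The truncated transforms approach \<open>U\<close> in L2 by definition, and their norms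
  equal those of the truncations of \<open>u\<close>, which converge by dominated
  convergence.\<close>

lemma is_fourier_plancherel:
  assumes [measurable]: "u \<in> borel_measurable borel" and u: "integrable lborel (\<lambda>x. (u x)\<^sup>2)"
    and U: "is_fourier u U"
  shows integrable_norm_fourier_square: "integrable lborel (\<lambda>\<xi>. (cmod (U \<xi>))\<^sup>2)"
    and integral_norm_fourier_square: "(LINT \<xi>|lborel. (cmod (U \<xi>))\<^sup>2) = (LINT x|lborel. (u x)\<^sup>2)"
proof -
  have [measurable]: "U \<in> borel_measurable borel" using U by (simp add: is_fourier_def)
  have "(\<integral>\<^sup>+ \<xi>. ennreal ((cmod (U \<xi>))\<^sup>2) \<partial>lborel) = ennreal (LINT x|lborel. (u x)\<^sup>2)"
  proof (rule nn_integral_norm_square_tendsto_unique[where F=at_top and f="ft_trunc u"])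
    show "((\<lambda>R. \<integral>\<^sup>+ \<xi>. ennreal ((cmod (ft_trunc u R \<xi>))\<^sup>2) \<partial>lborel) \<longlongrightarrow> ennreal (LINT x|lborel. (u x)\<^sup>2)) at_top"
      using tendsto_ennrealI[OF integral_space_trunc_tendsto[OF assms(1) u]]
      by (simp add: ft_trunc_eq_ft plancherel_nn space_trunc_integrable u nn_integral_eq_integral)
    show "((\<lambda>R. \<integral>\<^sup>+ \<xi>. ennreal ((cmod (ft_trunc u R \<xi> - U \<xi>))\<^sup>2) \<partial>lborel) \<longlongrightarrow> 0) at_top"
      using U by (simp add: is_fourier_def)
  qed auto
  note eq = this
  show "integrable lborel (\<lambda>\<xi>. (cmod (U \<xi>))\<^sup>2)"
    by (rule integrableI_nn_integral_finite[OF _ _ eq]) auto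
  show "(LINT \<xi>|lborel. (cmod (U \<xi>))\<^sup>2) = (LINT x|lborel. (u x)\<^sup>2)"
    by (rule integral_eq_nn_integral[THEN trans]) (auto simp: eq)
qed

lemma nn_integral_norm_square_add_le:
  fixes F G :: "'a \<Rightarrow> complex"
  assumes [measurable]: "F \<in> borel_measurable M" "G \<in> borel_measurable M"
  shows "(\<integral>\<^sup>+ x. ennreal ((cmod (F x + G x))\<^sup>2) \<partial>M)
    \<le> 2 * (\<integral>\<^sup>+ x. ennreal ((cmod (F x))\<^sup>2) \<partial>M) + 2 * (\<integral>\<^sup>+ x. ennreal ((cmod (G x))\<^sup>2) \<partial>M)"
  using nn_integral_norm_square_le[of "\<lambda>x. F x + G x" M F 1] by simp

lemma is_fourier_linear:
  assumes [measurable]: "u \<in> borel_measurable borel" "v \<in> borel_measurable borel"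
    and u: "integrable lborel (\<lambda>x. (u x)\<^sup>2)" and v: "integrable lborel (\<lambda>x. (v x)\<^sup>2)"
    and U: "is_fourier u U" and V: "is_fourier v V"
  shows "is_fourier (\<lambda>x. a * u x + b * v x) (\<lambda>\<xi>. complex_of_real a * U \<xi> + complex_of_real b * V \<xi>)"
  unfolding is_fourier_def
proof
  have [measurable]: "U \<in> borel_measurable borel" "V \<in> borel_measurable borel" using U V by (auto simp: is_fourier_def)
  show "(\<lambda>\<xi>. complex_of_real a * U \<xi> + complex_of_real b * V \<xi>) \<in> borel_measurable lborel" by measurable
  let ?D = "\<lambda>u U R. \<integral>\<^sup>+ \<xi>. ennreal ((cmod (ft_trunc u R \<xi> - U \<xi>))\<^sup>2) \<partial>lborel"
  have lin: "ft_trunc (\<lambda>x. a * u x + b * v x) R \<xi> = complex_of_real a * ft_trunc u R \<xi> + complex_of_real b * ft_trunc v R \<xi>" for R \<xi>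
  proof -
    have i: "integrable lborel (\<lambda>x. cis (- 2 * pi * x * \<xi>) * (complex_of_real a * space_trunc u R x))"
      "integrable lborel (\<lambda>x. cis (- 2 * pi * x * \<xi>) * (complex_of_real b * space_trunc v R x))"
      using integrable_cis_mult[of "\<lambda>x. complex_of_real a * space_trunc u R x" "-2*pi" \<xi>]
        integrable_cis_mult[of "\<lambda>x. complex_of_real b * space_trunc v R x" "-2*pi" \<xi>]
        integrable_space_trunc[OF _ u, of R] integrable_space_trunc[OF _ v, of R] by auto
    have "ft_trunc (\<lambda>x. a * u x + b * v x) R \<xi> = (LINT x|lborel. cis (- 2 * pi * x * \<xi>) * (complex_of_real a * space_trunc u R x)
        + cis (- 2 * pi * x * \<xi>) * (complex_of_real b * space_trunc v R x))"
      unfolding ft_trunc_eq_ft ft_def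
      by (intro Bochner_Integration.integral_cong) (auto simp: space_trunc_def algebra_simps)
    also have "\<dots> = (LINT x|lborel. cis (- 2 * pi * x * \<xi>) * (complex_of_real a * space_trunc u R x))
        + (LINT x|lborel. cis (- 2 * pi * x * \<xi>) * (complex_of_real b * space_trunc v R x))"
      by (rule Bochner_Integration.integral_add[OF i])
    also have "\<dots> = complex_of_real a * ft_trunc u R \<xi> + complex_of_real b * ft_trunc v R \<xi>"
      unfolding ft_trunc_eq_ft ft_def by (simp add: mult.left_commute)
    finally show ?thesis .
  qed
  have bd: "?D (\<lambda>x. a * u x + b * v x) (\<lambda>\<xi>. complex_of_real a * U \<xi> + complex_of_real b * V \<xi>) R
      \<le> 2 * (ennreal (a\<^sup>2) * ?D u U R) + 2 * (ennreal (b\<^sup>2) * ?D v V R)" for R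
  proof -
    have "?D (\<lambda>x. a * u x + b * v x) (\<lambda>\<xi>. complex_of_real a * U \<xi> + complex_of_real b * V \<xi>) R
       = (\<integral>\<^sup>+ \<xi>. ennreal ((cmod (complex_of_real a * (ft_trunc u R \<xi> - U \<xi>) + complex_of_real b * (ft_trunc v R \<xi> - V \<xi>)))\<^sup>2) \<partial>lborel)"
      by (simp add: lin algebra_simps)
    also have "\<dots> \<le> 2 * (\<integral>\<^sup>+ \<xi>. ennreal ((cmod (complex_of_real a * (ft_trunc u R \<xi> - U \<xi>)))\<^sup>2) \<partial>lborel)
       + 2 * (\<integral>\<^sup>+ \<xi>. ennreal ((cmod (complex_of_real b * (ft_trunc v R \<xi> - V \<xi>)))\<^sup>2) \<partial>lborel)"
      by (rule nn_integral_norm_square_add_le) measurable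
    finally show ?thesis
      by (simp add: norm_mult power_mult_distrib ennreal_mult nn_integral_cmult)
  qed
  have l: "((\<lambda>R. 2 * (ennreal (a\<^sup>2) * ?D u U R) + 2 * (ennreal (b\<^sup>2) * ?D v V R)) \<longlongrightarrow> 2 * (ennreal (a\<^sup>2) * 0) + 2 * (ennreal (b\<^sup>2) * 0)) at_top"
    using U V by (intro tendsto_add ennreal_tendsto_cmult) (auto simp: is_fourier_def)
  show "(?D (\<lambda>x. a * u x + b * v x) (\<lambda>\<xi>. complex_of_real a * U \<xi> + complex_of_real b * V \<xi>) \<longlongrightarrow> 0) at_top"
    by (rule tendsto_sandwich[OF _ _ tendsto_const]) (use l bd in \<open>auto\<close>)
qed

lemma integrable_mult_square_integrable:
  fixes u v :: "'a \<Rightarrow> 'b::{real_normed_algebra, banach, second_countable_topology}"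
  assumes [measurable]: "u \<in> borel_measurable M" "v \<in> borel_measurable M"
    and u: "integrable M (\<lambda>x. (norm (u x))\<^sup>2)" and v: "integrable M (\<lambda>x. (norm (v x))\<^sup>2)"
  shows "integrable M (\<lambda>x. u x * v x)"
proof (rule Bochner_Integration.integrable_bound)
  show "integrable M (\<lambda>x. (norm (u x))\<^sup>2 + (norm (v x))\<^sup>2)" using u v by simp
  have "norm (u x * v x) \<le> (norm (u x))\<^sup>2 + (norm (v x))\<^sup>2" for x
    using norm_mult_ineq[of "u x" "v x"] sum_squares_bound[of "norm (u x)" "norm (v x)"]
      mult_nonneg_nonneg[OF norm_ge_zero[of "u x"] norm_ge_zero[of "v x"]] by linarith
  then show "AE x in M. norm (u x * v x) \<le> norm ((norm (u x))\<^sup>2 + (norm (v x))\<^sup>2)" by simp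
qed measurable

text \<open>Polarisation with the single sum \<open>u + v\<close>: since both functions are real,
  the real part that this sum sees is the whole pairing.\<close>

lemma is_fourier_parseval:
  assumes [measurable]: "u \<in> borel_measurable borel" "v \<in> borel_measurable borel"
    and u: "integrable lborel (\<lambda>x. (u x)\<^sup>2)" and v: "integrable lborel (\<lambda>x. (v x)\<^sup>2)"
    and U: "is_fourier u U" and V: "is_fourier v V"
  shows "(LINT x|lborel. u x * v x) = Re (LINT \<xi>|lborel. U \<xi> * cnj (V \<xi>))"
proof -
  have [measurable]: "U \<in> borel_measurable borel" "V \<in> borel_measurable borel" using U V by (auto simp: is_fourier_def)
  note PU = is_fourier_plancherel[OF assms(1) u U] and PV = is_fourier_plancherel[OF assms(2) v V]
  have uv: "integrable lborel (\<lambda>x. u x * v x)"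
    using u v by (intro integrable_mult_square_integrable) auto
  have UV: "integrable lborel (\<lambda>\<xi>. U \<xi> * cnj (V \<xi>))"
    using PU(1) PV(1) by (intro integrable_mult_square_integrable) auto
  have e1: "(u x + v x)\<^sup>2 = (u x)\<^sup>2 + 2 * (u x * v x) + (v x)\<^sup>2" for x
    by (simp add: power2_eq_square algebra_simps)
  have e2: "(cmod (U \<xi> + V \<xi>))\<^sup>2 = (cmod (U \<xi>))\<^sup>2 + 2 * Re (U \<xi> * cnj (V \<xi>)) + (cmod (V \<xi>))\<^sup>2" for \<xi>
    unfolding cmod_power2 by (simp add: power2_eq_square algebra_simps)
  have s: "integrable lborel (\<lambda>x. (u x + v x)\<^sup>2)" unfolding e1 using u v uv by simp
  have F: "is_fourier (\<lambda>x. u x + v x) (\<lambda>\<xi>. U \<xi> + V \<xi>)"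
    using is_fourier_linear[OF assms(1,2) u v U V, of 1 1] by simp
  have "(LINT \<xi>|lborel. (cmod (U \<xi> + V \<xi>))\<^sup>2) = (LINT x|lborel. (u x + v x)\<^sup>2)"
    by (rule integral_norm_fourier_square[OF _ s F]) measurable
  then have "(LINT \<xi>|lborel. (cmod (U \<xi>))\<^sup>2) + 2 * (LINT \<xi>|lborel. Re (U \<xi> * cnj (V \<xi>))) + (LINT \<xi>|lborel. (cmod (V \<xi>))\<^sup>2)
     = (LINT x|lborel. (u x)\<^sup>2) + 2 * (LINT x|lborel. u x * v x) + (LINT x|lborel. (v x)\<^sup>2)"
    unfolding e1 e2 using u v uv PU(1) PV(1) integrable_Re[OF UV] by (simp del: times_complex.simps)
  then show ?thesis using PU(2) PV(2) UV by (simp del: times_complex.simps)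
qed

lemma ft_cnj: "ft (\<lambda>x. cnj (V x)) \<xi> = cnj (ft V (- \<xi>))"
proof -
  have "ft (\<lambda>x. cnj (V x)) \<xi> = (LINT x|lborel. cnj (cis (- 2 * pi * x * (- \<xi>)) * V x))"
    unfolding ft_def by (simp add: cis_cnj)
  then show ?thesis unfolding ft_def by (simp only: Bochner_Integration.integral_cnj)
qed

lemma ft_reflect: "ft (\<lambda>x. V (- x)) \<xi> = ft V (- \<xi>)"
  unfolding ft_def using lborel_integral_real_affine[of "-1" "\<lambda>x. cis (- 2 * pi * x * (- \<xi>)) * V x" 0] by simp

text \<open>The truncated transforms of a real function have this symmetry exactly; it survives in
  the L2 limit, almost everywhere. It is what allows multiplied transforms to be inverted to real
  test functions.\<close>

lemma is_fourier_hermitian: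
  assumes [measurable]: "u \<in> borel_measurable borel" and U: "is_fourier u U"
  shows "AE \<xi> in lborel. U (- \<xi>) = cnj (U \<xi>)"
proof -
  have [measurable]: "U \<in> borel_measurable borel" using U by (auto simp: is_fourier_def)
  let ?D = "\<lambda>R. \<integral>\<^sup>+ \<xi>. ennreal ((cmod (ft_trunc u R \<xi> - U \<xi>))\<^sup>2) \<partial>lborel"
  let ?I = "\<integral>\<^sup>+ \<xi>. ennreal ((cmod (U (- \<xi>) - cnj (U \<xi>)))\<^sup>2) \<partial>lborel"
  have herm: "ft_trunc u R (- \<xi>) = cnj (ft_trunc u R \<xi>)" for R \<xi>
  proof -
    have "(\<lambda>x. cnj (space_trunc u R x)) = space_trunc u R" by (auto simp: space_trunc_def)
    then show ?thesis using ft_cnj[of "space_trunc u R" "- \<xi>"] by (simp add: ft_trunc_eq_ft)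
  qed
  have "?I \<le> 2 * ?D R + 2 * ?D R" for R
  proof -
    have "?I = (\<integral>\<^sup>+ \<xi>. ennreal ((cmod ((U (- \<xi>) - ft_trunc u R (- \<xi>)) + cnj (ft_trunc u R \<xi> - U \<xi>)))\<^sup>2) \<partial>lborel)"
      by (simp add: herm)
    also have "\<dots> \<le> 2 * (\<integral>\<^sup>+ \<xi>. ennreal ((cmod (U (- \<xi>) - ft_trunc u R (- \<xi>)))\<^sup>2) \<partial>lborel)
       + 2 * (\<integral>\<^sup>+ \<xi>. ennreal ((cmod (cnj (ft_trunc u R \<xi> - U \<xi>)))\<^sup>2) \<partial>lborel)"
      by (rule nn_integral_norm_square_add_le) measurable
    also have "(\<integral>\<^sup>+ \<xi>. ennreal ((cmod (U (- \<xi>) - ft_trunc u R (- \<xi>)))\<^sup>2) \<partial>lborel) = ?D R"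
      using nn_integral_real_affine[of "\<lambda>\<xi>. ennreal ((cmod (ft_trunc u R \<xi> - U \<xi>))\<^sup>2)" "-1" 0]
      by (simp add: norm_minus_commute)
    also have "(\<integral>\<^sup>+ \<xi>. ennreal ((cmod (cnj (ft_trunc u R \<xi> - U \<xi>)))\<^sup>2) \<partial>lborel) = ?D R"
      by (simp only: complex_mod_cnj)
    finally show ?thesis .
  qed
  moreover have "((\<lambda>R. 2 * ?D R + 2 * ?D R) \<longlongrightarrow> 2 * 0 + 2 * 0) at_top"
    using U by (intro tendsto_add ennreal_tendsto_cmult) (auto simp: is_fourier_def)
  ultimately have "?I \<le> 2 * 0 + 2 * 0"
    by (intro tendsto_lowerbound[where F=at_top]) auto
  then have "?I = 0" by simp
  then have "AE \<xi> in lborel. ennreal ((cmod (U (- \<xi>) - cnj (U \<xi>)))\<^sup>2) = 0"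
    by (subst (asm) nn_integral_0_iff_AE) auto
  then show ?thesis by eventually_elim simp
qed

text \<open>Expanding the square, the distance of the truncated transform of the inverse transform to V is
  the part of the L2 mass of the inverse transform outside [-R,R].\<close>
lemma is_fourier_inverse:
  assumes V: "integrable lborel V" and V2: "integrable lborel (\<lambda>\<xi>. (cmod (V \<xi>))\<^sup>2)"
    and herm: "AE \<xi> in lborel. V (- \<xi>) = cnj (V \<xi>)"
  shows "is_fourier (\<lambda>x. Re (ft V (- x))) V"
    and "integrable lborel (\<lambda>x. (Re (ft V (- x)))\<^sup>2)"
proof -
  have [measurable]: "V \<in> borel_measurable borel" using V by auto
  define \<phi> where "\<phi> = (\<lambda>x. Re (ft V (- x)))"
  have [measurable]: "\<phi> \<in> borel_measurable borel" unfolding \<phi>_def by measurable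
  \<comment> \<open>Hermitian symmetry makes the inverse transform real, so that taking
    \<open>Re\<close> discards nothing.\<close>
  have real: "complex_of_real (\<phi> x) = ft V (- x)" for x
  proof -
    have "cnj (ft V (- x)) = ft (\<lambda>\<xi>. cnj (V \<xi>)) x" by (simp add: ft_cnj)
    also have "\<dots> = ft (\<lambda>\<xi>. V (- \<xi>)) x"
      unfolding ft_def using herm by (intro integral_cong_AE) auto
    also have "\<dots> = ft V (- x)" by (rule ft_reflect)
    finally show ?thesis by (auto simp: \<phi>_def complex_eq_iff)
  qed
  have sq: "(\<phi> x)\<^sup>2 = (cmod (ft V (0 + (-1) * x)))\<^sup>2" for x
    by (simp flip: real)
  have \<phi>2: "integrable lborel (\<lambda>x. (\<phi> x)\<^sup>2)"
    unfolding sq using lborel_integrable_real_affine[OF integrable_norm_ft_square[OF V V2], of "-1" 0] by simp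
  then show "integrable lborel (\<lambda>x. (Re (ft V (- x)))\<^sup>2)" by (simp add: \<phi>_def)
  have \<phi>I: "(LINT x|lborel. (\<phi> x)\<^sup>2) = (LINT \<xi>|lborel. (cmod (V \<xi>))\<^sup>2)"
    unfolding sq using lborel_integral_real_affine[of "-1" "\<lambda>x. (cmod (ft V x))\<^sup>2" 0] integral_norm_ft_square[OF V V2] by simp
  have dist: "(\<integral>\<^sup>+ \<xi>. ennreal ((cmod (ft_trunc \<phi> R \<xi> - V \<xi>))\<^sup>2) \<partial>lborel)
      = ennreal ((LINT x|lborel. (\<phi> x)\<^sup>2) - (LINT x|lborel. (cmod (space_trunc \<phi> R x))\<^sup>2))" for R
  proof -
    let ?A = "LINT x|lborel. (cmod (space_trunc \<phi> R x))\<^sup>2"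
    note S = space_trunc_integrable[OF \<open>\<phi> \<in> borel_measurable borel\<close> \<phi>2, of R]
    note P = plancherel[OF S]
    have FV: "integrable lborel (\<lambda>\<xi>. ft_trunc \<phi> R \<xi> * cnj (V \<xi>))"
      using P(1) V2 by (intro integrable_mult_square_integrable) (auto simp: ft_trunc_eq_ft)
    \<comment> \<open>The multiplication formula moves the transform onto \<open>cnj V\<close>,
      where it returns \<open>\<phi>\<close>. The cross term is thus the truncated mass itself and
      enters the square with coefficient -2, leaving a net \<open>- ?A\<close>.\<close>
    have "(LINT \<xi>|lborel. ft_trunc \<phi> R \<xi> * cnj (V \<xi>)) = (LINT x|lborel. space_trunc \<phi> R x * ft (\<lambda>x. cnj (V x)) x)"
      unfolding ft_trunc_eq_ft using V by (intro ft_mult_integral S) auto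
    also have "\<dots> = (LINT x|lborel. complex_of_real ((cmod (space_trunc \<phi> R x))\<^sup>2))"
      by (intro Bochner_Integration.integral_cong)
         (auto simp: ft_cnj space_trunc_def indicator_def power2_eq_square simp flip: real of_real_mult)
    also have "\<dots> = complex_of_real ?A" by (rule integral_complex_of_real)
    finally have cross: "(LINT \<xi>|lborel. ft_trunc \<phi> R \<xi> * cnj (V \<xi>)) = complex_of_real ?A" .
    have e: "(cmod (ft_trunc \<phi> R \<xi> - V \<xi>))\<^sup>2 = (cmod (ft_trunc \<phi> R \<xi>))\<^sup>2 - 2 * Re (ft_trunc \<phi> R \<xi> * cnj (V \<xi>)) + (cmod (V \<xi>))\<^sup>2" for \<xi>
      unfolding cmod_power2 by (simp add: power2_eq_square algebra_simps)
    have i: "integrable lborel (\<lambda>\<xi>. (cmod (ft_trunc \<phi> R \<xi> - V \<xi>))\<^sup>2)"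
      unfolding e using P(1) V2 integrable_Re[OF FV] by (simp add: ft_trunc_eq_ft del: times_complex.simps)
    have "(LINT \<xi>|lborel. (cmod (ft_trunc \<phi> R \<xi> - V \<xi>))\<^sup>2) = ?A - 2 * ?A + (LINT \<xi>|lborel. (cmod (V \<xi>))\<^sup>2)"
      unfolding e using P V2 FV integrable_Re[OF FV] cross by (simp add: ft_trunc_eq_ft del: times_complex.simps)
    then show ?thesis using \<phi>I by (simp add: nn_integral_eq_integral[OF i])
  qed
  have "((\<lambda>R. ennreal ((LINT x|lborel. (\<phi> x)\<^sup>2) - (LINT x|lborel. (cmod (space_trunc \<phi> R x))\<^sup>2)))
      \<longlongrightarrow> ennreal ((LINT x|lborel. (\<phi> x)\<^sup>2) - (LINT x|lborel. (\<phi> x)\<^sup>2))) at_top"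
    by (intro tendsto_ennrealI tendsto_diff tendsto_const integral_space_trunc_tendsto \<phi>2) measurable
  then show "is_fourier (\<lambda>x. Re (ft V (- x))) V"
    unfolding \<phi>_def[symmetric] is_fourier_def dist by simp
qed

text \<open>The product \<open>w * U\<close> is both integrable and square integrable, so its
  inverse transform is an honest integral, which gives the pointwise bound. Evenness of
  \<open>w\<close> preserves Hermitian symmetry, hence real values. Sharp cutoffs in the embedding
  and weighted test functions in the energy estimate are both instances.\<close>

lemma frequency_cutoff:
  assumes [measurable]: "u \<in> borel_measurable borel" and u: "integrable lborel (\<lambda>x. (u x)\<^sup>2)"
    and U: "is_fourier u U"
    and [measurable]: "w \<in> borel_measurable borel" and even: "\<And>\<xi>. w (- \<xi>) = w \<xi>"
    and w: "\<And>\<xi>. \<bar>w \<xi>\<bar> \<le> B" "\<And>\<xi>. \<bar>\<xi>\<bar> > N \<Longrightarrow> w \<xi> = 0"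
  obtains \<phi> where "\<phi> \<in> borel_measurable borel" "integrable lborel (\<lambda>x. (\<phi> x)\<^sup>2)"
    "is_fourier \<phi> (\<lambda>\<xi>. complex_of_real (w \<xi>) * U \<xi>)"
    "\<And>x. \<bar>\<phi> x\<bar> \<le> (LINT \<xi>|lborel. \<bar>w \<xi>\<bar> * cmod (U \<xi>))"
proof -
  have [measurable]: "U \<in> borel_measurable borel" using U by (auto simp: is_fourier_def)
  note U2 = integrable_norm_fourier_square[OF assms(1) u U]
  let ?V = "\<lambda>\<xi>. complex_of_real (w \<xi>) * U \<xi>"
  have V: "integrable lborel ?V"
    using integrable_if_square_integrable[OF _ _ U2 w] by (simp add: scaleR_conv_of_real)
  have V2: "integrable lborel (\<lambda>\<xi>. (cmod (?V \<xi>))\<^sup>2)"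
  proof (rule Bochner_Integration.integrable_bound)
    show "integrable lborel (\<lambda>\<xi>. B\<^sup>2 * (cmod (U \<xi>))\<^sup>2)" using U2 by simp
    have "\<bar>w \<xi>\<bar>\<^sup>2 \<le> B\<^sup>2" for \<xi> by (intro power_mono w) auto
    then show "AE \<xi> in lborel. norm ((cmod (?V \<xi>))\<^sup>2) \<le> norm (B\<^sup>2 * (cmod (U \<xi>))\<^sup>2)"
      by (auto intro!: AE_I2 mult_right_mono simp: norm_mult power_mult_distrib)
  qed measurable
  have herm: "AE \<xi> in lborel. ?V (- \<xi>) = cnj (?V \<xi>)"
    using is_fourier_hermitian[OF assms(1) U] by eventually_elim (simp add: even)
  show thesis
  proof (rule that)
    show "is_fourier (\<lambda>x. Re (ft ?V (- x))) ?V" "integrable lborel (\<lambda>x. (Re (ft ?V (- x)))\<^sup>2)"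
      by (rule is_fourier_inverse[OF V V2 herm])+
    show "\<bar>Re (ft ?V (- x))\<bar> \<le> (LINT \<xi>|lborel. \<bar>w \<xi>\<bar> * cmod (U \<xi>))" for x
      using abs_Re_le_cmod[of "ft ?V (- x)"] norm_ft_le[of ?V "- x"] by (simp add: norm_mult)
  qed measurable
qed

section \<open>Sobolev embedding\<close>

lemma nn_integral_powr_from_0:
  fixes a b :: real
  assumes "b > 0" "a \<ge> 0"
  shows "(\<integral>\<^sup>+ l. (if 0 \<le> l \<and> l \<le> a then ennreal (l powr (b - 1)) else 0) \<partial>lborel) = ennreal (a powr b / b)"
proof -
  have "((\<lambda>x. x powr (b - 1)) has_integral (a powr (b - 1 + 1) / (b - 1 + 1))) {0..a}"
    using assms by (intro has_integral_powr_from_0) auto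
  then have "((\<lambda>x. x powr (b - 1)) has_integral (a powr b / b)) {0..a}" by simp
  from nn_integral_has_integral_lebesgue[OF _ this]
  have "ennreal (a powr b / b) = (\<integral>\<^sup>+ l. ennreal (indicator {0..a} l * l powr (b - 1)) \<partial>lborel)" by simp
  also have "\<dots> = (\<integral>\<^sup>+ l. (if 0 \<le> l \<and> l \<le> a then ennreal (l powr (b - 1)) else 0) \<partial>lborel)"
    by (intro nn_integral_cong) (auto simp: indicator_def)
  finally show ?thesis by simp
qed

lemma power2_powr: "(x\<^sup>2) powr r = \<bar>x :: real\<bar> powr (2 * r)"
proof -
  have "\<bar>x\<bar> powr 2 = x\<^sup>2" by (cases "x = 0") auto
  then show ?thesis using powr_powr[of "\<bar>x\<bar>" 2 r] by simp
qed

text \<open>Cauchy-Schwarz against the weight \<open>\<bar>\<xi>\<bar> powr (- 2 * r)\<close>, which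
  is integrable at the origin because 2r < 1. It is carried out pointwise, as a weighted
  arithmetic-geometric mean inequality.\<close>

lemma low_frequency_bound:
  fixes U :: "real \<Rightarrow> complex"
  assumes r: "0 < r" "r < 1 / 2" and A: "A > 0"
    and [measurable]: "U \<in> borel_measurable borel"
    and U: "integrable lborel (\<lambda>\<xi>. (1 + \<xi>\<^sup>2) powr r * (cmod (U \<xi>))\<^sup>2)"
    and U1: "(LINT \<xi>|lborel. (1 + \<xi>\<^sup>2) powr r * (cmod (U \<xi>))\<^sup>2) \<le> 1"
  shows "(LINT \<xi>|lborel. indicat_real {-A..A} \<xi> * cmod (U \<xi>)) \<le> (1 / 2 + 1 / (1 - 2 * r)) * A powr (1 / 2 - r)"
proof -
  define g where "g = (\<lambda>\<xi>::real. if 0 \<le> \<xi> \<and> \<xi> \<le> A then \<xi> powr (- 2 * r) else 0)"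
  have [measurable]: "g \<in> borel_measurable borel" unfolding g_def by measurable
  have g0: "g \<xi> \<ge> 0" for \<xi> by (simp add: g_def)
  have "(\<integral>\<^sup>+ \<xi>. ennreal (g \<xi>) \<partial>lborel) = (\<integral>\<^sup>+ l. (if 0 \<le> l \<and> l \<le> A then ennreal (l powr ((1 - 2 * r) - 1)) else 0) \<partial>lborel)"
    by (intro nn_integral_cong) (auto simp: g_def)
  also have "\<dots> = ennreal (A powr (1 - 2 * r) / (1 - 2 * r))"
    using r A by (intro nn_integral_powr_from_0) auto
  finally have gn: "(\<integral>\<^sup>+ \<xi>. ennreal (g \<xi>) \<partial>lborel) = ennreal (A powr (1 - 2 * r) / (1 - 2 * r))" .
  have gi: "integrable lborel g" by (rule integrableI_nn_integral_finite[OF _ _ gn]) (auto simp: g0)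
  have gI: "integral\<^sup>L lborel g = A powr (1 - 2 * r) / (1 - 2 * r)"
    using r by (subst integral_eq_nn_integral) (auto simp: gn g0)
  have gi': "integrable lborel (\<lambda>\<xi>. g (- \<xi>))"
    using lborel_integrable_real_affine[OF gi, of "-1" 0] by simp
  have gI': "(LINT \<xi>|lborel. g (- \<xi>)) = A powr (1 - 2 * r) / (1 - 2 * r)"
    using lborel_integral_real_affine[of "-1" g 0] gI by simp
  \<comment> \<open>Balances the two halves of the mean inequality up to constants: the weight has
    integral \<open>2 * k\<^sup>2 / (1 - 2 * r)\<close> over \<open>{-A..A}\<close>, so both terms
    become multiples of \<open>k\<close>.\<close>
  define k where "k = A powr (1 / 2 - r)"
  have k: "k > 0" using A by (simp add: k_def)
  define h where "h = (\<lambda>\<xi>. 1 / 2 * (k * ((1 + \<xi>\<^sup>2) powr r * (cmod (U \<xi>))\<^sup>2) + 1 / k * (g \<xi> + g (- \<xi>))))"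
  have hi: "integrable lborel h" unfolding h_def
    using U gi gi' by (intro integrable_mult_right Bochner_Integration.integrable_add)
  \<comment> \<open>The origin is left out because \<open>0 powr (- 2 * r)\<close> is 0, so that
    \<open>g\<close> does not have the required size there.\<close>
  have ae: "AE \<xi> in lborel. indicat_real {-A..A} \<xi> * cmod (U \<xi>) \<le> h \<xi>"
    using AE_lborel_singleton[of 0]
  proof eventually_elim
    case (elim \<xi>)
    show ?case
    proof (cases "\<xi> \<in> {-A..A}")
      case False
      then show ?thesis using k g0 by (auto simp: h_def)
    next
      case True
      define y where "y = \<bar>\<xi>\<bar> powr r"
      have y: "y > 0" using elim by (simp add: y_def)
      have yy: "y\<^sup>2 = \<bar>\<xi>\<bar> powr (2 * r)"
        by (simp add: y_def power2_eq_square flip: powr_add)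
      have "\<bar>\<xi>\<bar> powr (- 2 * r) = 1 / y\<^sup>2"
        using elim by (simp add: yy powr_minus_divide)
      moreover have "g \<xi> + g (- \<xi>) = \<bar>\<xi>\<bar> powr (- 2 * r)"
        using elim True by (auto simp: g_def)
      ultimately have g: "g \<xi> + g (- \<xi>) = 1 / y\<^sup>2" by simp
      have "y\<^sup>2 = (\<xi>\<^sup>2) powr r"
        by (simp add: yy power2_powr)
      also have "\<dots> \<le> (1 + \<xi>\<^sup>2) powr r" using r by (intro powr_mono2) auto
      finally have y2: "y\<^sup>2 \<le> (1 + \<xi>\<^sup>2) powr r" .
      have "0 \<le> (k * y\<^sup>2 * cmod (U \<xi>) - 1)\<^sup>2 / (k * y\<^sup>2)" using k by simp
      also have "\<dots> = k * (y\<^sup>2 * (cmod (U \<xi>))\<^sup>2) - 2 * cmod (U \<xi>) + 1 / k * (1 / y\<^sup>2)"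
        using k y by (simp add: power2_eq_square field_simps)
      also have "\<dots> \<le> k * ((1 + \<xi>\<^sup>2) powr r * (cmod (U \<xi>))\<^sup>2) - 2 * cmod (U \<xi>) + 1 / k * (1 / y\<^sup>2)"
        using k y2 by (simp add: mult_left_mono mult_right_mono)
      finally show ?thesis using True by (simp add: h_def g mult_ac)
    qed
  qed
  have "(LINT \<xi>|lborel. indicat_real {-A..A} \<xi> * cmod (U \<xi>)) \<le> integral\<^sup>L lborel h"
  proof (rule integral_mono_AE[OF _ hi ae])
    show "integrable lborel (\<lambda>\<xi>. indicat_real {-A..A} \<xi> * cmod (U \<xi>))"
    proof (rule Bochner_Integration.integrable_bound[OF hi])
      show "AE \<xi> in lborel. norm (indicat_real {-A..A} \<xi> * cmod (U \<xi>)) \<le> norm (h \<xi>)"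
        using ae by eventually_elim (auto simp: abs_mult)
    qed measurable
  qed
  also have "integral\<^sup>L lborel h = 1 / 2 * (k * (LINT \<xi>|lborel. (1 + \<xi>\<^sup>2) powr r * (cmod (U \<xi>))\<^sup>2) + 1 / k * (A powr (1 - 2 * r) / (1 - 2 * r) + A powr (1 - 2 * r) / (1 - 2 * r)))"
    unfolding h_def using U gi gi' gI gI' by simp
  also have "\<dots> \<le> 1 / 2 * (k * 1 + 1 / k * (A powr (1 - 2 * r) / (1 - 2 * r) + A powr (1 - 2 * r) / (1 - 2 * r)))"
    using U1 k by (intro mult_left_mono add_mono order_refl) auto
  also have "A powr (1 - 2 * r) = k * k" by (simp add: k_def flip: powr_add)
  also have "1 / 2 * (k * 1 + 1 / k * (k * k / D + k * k / D)) = (1 / 2 + 1 / D) * k" for D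
    using k by (cases "D = 0") (simp_all add: field_simps)
  finally show ?thesis by (simp add: k_def)
qed

text \<open>The low-frequency part \<open>v\<close> is at most \<open>l / 2\<close> everywhere, so
  where \<open>\<bar>u x\<bar>\<close> reaches \<open>l\<close> it is at most twice
  \<open>\<bar>u x - v x\<bar>\<close>; squaring gives the factor 4. Plancherel turns the mass of
  \<open>u - v\<close> into high-frequency mass.\<close>

lemma level_set_mass_le:
  assumes [measurable]: "u \<in> borel_measurable borel" and u: "integrable lborel (\<lambda>x. (u x)\<^sup>2)"
    and U: "is_fourier u U" and l: "l > 0"
    and low: "(LINT \<xi>|lborel. indicat_real {-A..A} \<xi> * cmod (U \<xi>)) \<le> l / 2"
  shows "(\<integral>\<^sup>+ x. (if l \<le> \<bar>u x\<bar> then ennreal ((u x)\<^sup>2) else 0) \<partial>lborel)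
     \<le> 4 * (\<integral>\<^sup>+ \<xi>. (if A < \<bar>\<xi>\<bar> then ennreal ((cmod (U \<xi>))\<^sup>2) else 0) \<partial>lborel)"
proof -
  have [measurable]: "U \<in> borel_measurable borel" using U by (auto simp: is_fourier_def)
  obtain v where [measurable]: "v \<in> borel_measurable borel" and v: "integrable lborel (\<lambda>x. (v x)\<^sup>2)"
    and V: "is_fourier v (\<lambda>\<xi>. complex_of_real (indicat_real {-A..A} \<xi>) * U \<xi>)"
    and vb: "\<And>x. \<bar>v x\<bar> \<le> (LINT \<xi>|lborel. \<bar>indicat_real {-A..A} \<xi>\<bar> * cmod (U \<xi>))"
    by (rule frequency_cutoff[OF assms(1) u U, of "indicat_real {-A..A}" 1 A]) (auto simp: indicator_def)
  have vb: "\<bar>v x\<bar> \<le> l / 2" for x using vb[of x] low by simp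
  have F: "is_fourier (\<lambda>x. u x - v x) (\<lambda>\<xi>. complex_of_real (1 - indicat_real {-A..A} \<xi>) * U \<xi>)"
    using is_fourier_linear[OF assms(1) \<open>v \<in> _\<close> u v U V, of 1 "-1"] by (simp add: left_diff_distrib)
  have uv: "integrable lborel (\<lambda>x. u x * v x)"
    using u v by (intro integrable_mult_square_integrable) auto
  have d: "integrable lborel (\<lambda>x. (u x - v x)\<^sup>2)"
    using u v uv by (simp add: power2_diff mult.assoc)
  have "(\<integral>\<^sup>+ x. (if l \<le> \<bar>u x\<bar> then ennreal ((u x)\<^sup>2) else 0) \<partial>lborel) \<le> (\<integral>\<^sup>+ x. 4 * ennreal ((u x - v x)\<^sup>2) \<partial>lborel)"
  proof (rule nn_integral_mono)
    fix x
    show "(if l \<le> \<bar>u x\<bar> then ennreal ((u x)\<^sup>2) else 0) \<le> 4 * ennreal ((u x - v x)\<^sup>2)"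
    proof (cases "l \<le> \<bar>u x\<bar>")
      case True
      then have "\<bar>u x\<bar> \<le> \<bar>2 * (u x - v x)\<bar>" using vb[of x] abs_triangle_ineq[of "v x" "u x - v x"] by (simp add: abs_mult)
      then have "(u x)\<^sup>2 \<le> (2 * (u x - v x))\<^sup>2" by (simp only: abs_le_square_iff)
      then have "ennreal ((u x)\<^sup>2) \<le> ennreal (4 * (u x - v x)\<^sup>2)"
        unfolding power_mult_distrib by (intro ennreal_leI) simp
      then show ?thesis using True by (simp add: ennreal_mult)
    qed simp
  qed
  also have "\<dots> = 4 * (\<integral>\<^sup>+ x. ennreal ((u x - v x)\<^sup>2) \<partial>lborel)" by (rule nn_integral_cmult) measurable
  also have "(\<integral>\<^sup>+ x. ennreal ((u x - v x)\<^sup>2) \<partial>lborel) = ennreal (LINT x|lborel. (u x - v x)\<^sup>2)"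
    by (rule nn_integral_eq_integral[OF d]) simp
  also have "\<dots> = ennreal (LINT \<xi>|lborel. (cmod (complex_of_real (1 - indicat_real {-A..A} \<xi>) * U \<xi>))\<^sup>2)"
    using integral_norm_fourier_square[OF _ d F] by simp
  also have "\<dots> = (\<integral>\<^sup>+ \<xi>. ennreal ((cmod (complex_of_real (1 - indicat_real {-A..A} \<xi>) * U \<xi>))\<^sup>2) \<partial>lborel)"
    by (rule nn_integral_eq_integral[OF integrable_norm_fourier_square[OF _ d F], symmetric]) auto
  also have "\<dots> = (\<integral>\<^sup>+ \<xi>. (if A < \<bar>\<xi>\<bar> then ennreal ((cmod (U \<xi>))\<^sup>2) else 0) \<partial>lborel)"
    by (intro nn_integral_cong) (auto simp: indicator_def)
  finally show ?thesis .
qed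

text \<open>This is 4 (2K)^(q-2), with K the constant of \<open>low_frequency_bound\<close>, q =
  2/(1-2r) the embedding exponent, and 4 the factor of \<open>level_set_mass_le\<close>.\<close>

definition sobolev_const :: "real \<Rightarrow> real" where
  "sobolev_const r = 4 * (2 * (1 / 2 + 1 / (1 - 2 * r))) powr (2 / (1 - 2 * r) - 2)"

text \<open>The level-set proof of Chemin and Xu: at height l, cut the frequencies at the radius for which the
  low-frequency part is at most l/2 everywhere.\<close>
theorem sobolev_embedding:
  assumes r: "0 < r" "r < 1 / 2"
    and [measurable]: "u \<in> borel_measurable borel" and u: "integrable lborel (\<lambda>x. (u x)\<^sup>2)"
    and U: "is_fourier u U"
    and Ui: "integrable lborel (\<lambda>\<xi>. (1 + \<xi>\<^sup>2) powr r * (cmod (U \<xi>))\<^sup>2)"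
    and U1: "(LINT \<xi>|lborel. (1 + \<xi>\<^sup>2) powr r * (cmod (U \<xi>))\<^sup>2) \<le> 1"
  shows "(\<integral>\<^sup>+ x. ennreal (\<bar>u x\<bar> powr (2 / (1 - 2 * r))) \<partial>lborel) \<le> ennreal (sobolev_const r)"
proof -
  have [measurable]: "U \<in> borel_measurable borel" using U by (auto simp: is_fourier_def)
  define q where "q = 2 / (1 - 2 * r)"
  define b where "b = q - 2"
  define K where "K = 1 / 2 + 1 / (1 - 2 * r)"
  have q: "q > 2" using r by (simp add: q_def field_simps)
  have b: "b > 0" using q by (simp add: b_def)
  have K: "K > 0" using r by (simp add: K_def add_pos_pos)
  have qr: "q * (1 / 2 - r) = 1" using r by (simp add: q_def field_simps)
  have b2r: "b / q = 2 * r" using r q by (simp add: q_def b_def field_simps)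
  \<comment> \<open>Solves \<open>K * A powr (1 / 2 - r) = l / 2\<close>, since
    \<open>q * (1 / 2 - r) = 1\<close>.\<close>
  define A where "A = (\<lambda>l. (l / (2 * K)) powr q)"
  define W where "W = (\<lambda>l. if 0 \<le> l then ennreal (l powr (b - 1)) else 0)"
  have [measurable]: "W \<in> borel_measurable borel" unfolding W_def by measurable
  \<comment> \<open>Layer-cake formula for the power q - 2 only; the remaining factor
    \<open>(u x)\<^sup>2\<close> is kept, so that level sets are measured by L2 mass and Plancherel
    applies.\<close>
  have layer: "ennreal (\<bar>u x\<bar> powr q) = ennreal b * (\<integral>\<^sup>+ l. W l * (if l \<le> \<bar>u x\<bar> then ennreal ((u x)\<^sup>2) else 0) \<partial>lborel)" for x
  proof -
    have "(\<integral>\<^sup>+ l. W l * (if l \<le> \<bar>u x\<bar> then ennreal ((u x)\<^sup>2) else 0) \<partial>lborel)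
      = (\<integral>\<^sup>+ l. ennreal ((u x)\<^sup>2) * (if 0 \<le> l \<and> l \<le> \<bar>u x\<bar> then ennreal (l powr (b - 1)) else 0) \<partial>lborel)"
      by (intro nn_integral_cong) (auto simp: W_def mult.commute)
    also have "\<dots> = ennreal ((u x)\<^sup>2) * ennreal (\<bar>u x\<bar> powr b / b)"
      using b by (subst nn_integral_cmult) (auto simp: nn_integral_powr_from_0)
    also have "ennreal b * \<dots> = ennreal (\<bar>u x\<bar>\<^sup>2 * \<bar>u x\<bar> powr b)"
      using b by (simp flip: ennreal_mult)
    also have "\<bar>u x\<bar>\<^sup>2 * \<bar>u x\<bar> powr b = \<bar>u x\<bar> powr q"
      by (cases "u x = 0") (auto simp: b_def powr_diff)
    finally show ?thesis ..
  qed
  have level: "W l * (\<integral>\<^sup>+ x. (if l \<le> \<bar>u x\<bar> then ennreal ((u x)\<^sup>2) else 0) \<partial>lborel)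
     \<le> W l * (4 * (\<integral>\<^sup>+ \<xi>. (if A l < \<bar>\<xi>\<bar> then ennreal ((cmod (U \<xi>))\<^sup>2) else 0) \<partial>lborel))" for l
  proof (cases "l > 0")
    case True
    have "(LINT \<xi>|lborel. indicat_real {-A l..A l} \<xi> * cmod (U \<xi>)) \<le> K * A l powr (1 / 2 - r)"
      unfolding K_def using True K r by (intro low_frequency_bound Ui U1) (auto simp: A_def)
    also have "A l powr (1 / 2 - r) = l / (2 * K)"
      using True K qr by (simp add: A_def powr_powr)
    finally have "(LINT \<xi>|lborel. indicat_real {-A l..A l} \<xi> * cmod (U \<xi>)) \<le> l / 2" using K by simp
    from level_set_mass_le[OF assms(3) u U True this] show ?thesis by (rule mult_left_mono) simp
  qed (cases "l = 0"; simp add: W_def)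
  have [measurable]: "A \<in> borel_measurable borel" unfolding A_def by measurable
  \<comment> \<open>For fixed \<xi> the condition \<open>A l < \<bar>\<xi>\<bar>\<close> bounds
    \<open>l\<close> by a multiple of \<open>\<bar>\<xi>\<bar> powr (1 / q)\<close>. Integrating
    produces the power (q-2)/q = 2r of \<open>\<bar>\<xi>\<bar>\<close>, which is the Sobolev
    weight.\<close>
  have inner: "(\<integral>\<^sup>+ l. W l * (if A l < \<bar>\<xi>\<bar> then ennreal ((cmod (U \<xi>))\<^sup>2) else 0) \<partial>lborel)
      \<le> ennreal (((2 * K) powr b * (1 + \<xi>\<^sup>2) powr r * (cmod (U \<xi>))\<^sup>2) / b)" for \<xi>
  proof -
    define a where "a = 2 * K * \<bar>\<xi>\<bar> powr (1 / q)"
    have a0: "a \<ge> 0" using K by (simp add: a_def)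
    have la: "l \<le> a" if "0 \<le> l" "A l < \<bar>\<xi>\<bar>" for l
    proof -
      have "(A l) powr (1 / q) \<le> \<bar>\<xi>\<bar> powr (1 / q)" using that q by (intro powr_mono2) (auto simp: A_def)
      moreover have "(A l) powr (1 / q) = l / (2 * K)" using that(1) K q by (simp add: A_def powr_powr)
      ultimately show ?thesis using K by (simp add: a_def field_simps)
    qed
    have "(\<integral>\<^sup>+ l. W l * (if A l < \<bar>\<xi>\<bar> then ennreal ((cmod (U \<xi>))\<^sup>2) else 0) \<partial>lborel)
       \<le> (\<integral>\<^sup>+ l. ennreal ((cmod (U \<xi>))\<^sup>2) * (if 0 \<le> l \<and> l \<le> a then ennreal (l powr (b - 1)) else 0) \<partial>lborel)"
      using la by (intro nn_integral_mono) (auto simp: W_def mult.commute)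
    also have "\<dots> = ennreal ((cmod (U \<xi>))\<^sup>2) * ennreal (a powr b / b)"
      using b a0 by (subst nn_integral_cmult) (auto simp: nn_integral_powr_from_0)
    also have "\<dots> = ennreal ((cmod (U \<xi>))\<^sup>2 * (a powr b / b))" using b by (simp flip: ennreal_mult)
    also have "\<dots> \<le> ennreal (((2 * K) powr b * (1 + \<xi>\<^sup>2) powr r * (cmod (U \<xi>))\<^sup>2) / b)"
    proof (rule ennreal_leI)
      have "a powr b = (2 * K) powr b * \<bar>\<xi>\<bar> powr (2 * r)"
        using K b2r by (simp add: a_def powr_mult powr_powr)
      also have "\<bar>\<xi>\<bar> powr (2 * r) = (\<xi>\<^sup>2) powr r"
        by (simp add: power2_powr)
      also have "(2 * K) powr b * (\<xi>\<^sup>2) powr r \<le> (2 * K) powr b * (1 + \<xi>\<^sup>2) powr r"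
        using r by (intro mult_left_mono powr_mono2) auto
      finally have "(cmod (U \<xi>))\<^sup>2 * a powr b \<le> (cmod (U \<xi>))\<^sup>2 * ((2 * K) powr b * (1 + \<xi>\<^sup>2) powr r)"
        by (rule mult_left_mono) simp
      then show "(cmod (U \<xi>))\<^sup>2 * (a powr b / b) \<le> ((2 * K) powr b * (1 + \<xi>\<^sup>2) powr r * (cmod (U \<xi>))\<^sup>2) / b"
        using b by (simp add: divide_right_mono mult_ac)
    qed
    finally show ?thesis .
  qed
  have "(\<integral>\<^sup>+ x. ennreal (\<bar>u x\<bar> powr q) \<partial>lborel)
     = ennreal b * (\<integral>\<^sup>+ x. \<integral>\<^sup>+ l. W l * (if l \<le> \<bar>u x\<bar> then ennreal ((u x)\<^sup>2) else 0) \<partial>lborel \<partial>lborel)"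
    unfolding layer by (rule nn_integral_cmult) measurable
  also have "(\<integral>\<^sup>+ x. \<integral>\<^sup>+ l. W l * (if l \<le> \<bar>u x\<bar> then ennreal ((u x)\<^sup>2) else 0) \<partial>lborel \<partial>lborel)
     = (\<integral>\<^sup>+ l. \<integral>\<^sup>+ x. W l * (if l \<le> \<bar>u x\<bar> then ennreal ((u x)\<^sup>2) else 0) \<partial>lborel \<partial>lborel)"
    by (rule lborel_pair.Fubini'[symmetric]) measurable
  also have "\<dots> = (\<integral>\<^sup>+ l. W l * (\<integral>\<^sup>+ x. (if l \<le> \<bar>u x\<bar> then ennreal ((u x)\<^sup>2) else 0) \<partial>lborel) \<partial>lborel)"
    by (intro nn_integral_cong nn_integral_cmult) measurable
  also have "\<dots> \<le> (\<integral>\<^sup>+ l. W l * (4 * (\<integral>\<^sup>+ \<xi>. (if A l < \<bar>\<xi>\<bar> then ennreal ((cmod (U \<xi>))\<^sup>2) else 0) \<partial>lborel)) \<partial>lborel)"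
    by (intro nn_integral_mono level)
  also have "\<dots> = 4 * (\<integral>\<^sup>+ l. W l * (\<integral>\<^sup>+ \<xi>. (if A l < \<bar>\<xi>\<bar> then ennreal ((cmod (U \<xi>))\<^sup>2) else 0) \<partial>lborel) \<partial>lborel)"
    by (subst nn_integral_cmult[symmetric]) (measurable, simp add: mult.left_commute)
  also have "(\<integral>\<^sup>+ l. W l * (\<integral>\<^sup>+ \<xi>. (if A l < \<bar>\<xi>\<bar> then ennreal ((cmod (U \<xi>))\<^sup>2) else 0) \<partial>lborel) \<partial>lborel)
     = (\<integral>\<^sup>+ l. \<integral>\<^sup>+ \<xi>. W l * (if A l < \<bar>\<xi>\<bar> then ennreal ((cmod (U \<xi>))\<^sup>2) else 0) \<partial>lborel \<partial>lborel)"
    by (intro nn_integral_cong nn_integral_cmult[symmetric]) measurable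
  also have "\<dots> = (\<integral>\<^sup>+ \<xi>. \<integral>\<^sup>+ l. W l * (if A l < \<bar>\<xi>\<bar> then ennreal ((cmod (U \<xi>))\<^sup>2) else 0) \<partial>lborel \<partial>lborel)"
    by (rule lborel_pair.Fubini'[symmetric]) measurable
  also have "\<dots> \<le> (\<integral>\<^sup>+ \<xi>. ennreal (((2 * K) powr b * (1 + \<xi>\<^sup>2) powr r * (cmod (U \<xi>))\<^sup>2) / b) \<partial>lborel)"
    by (intro nn_integral_mono inner)
  also have "\<dots> = (\<integral>\<^sup>+ \<xi>. ennreal ((2 * K) powr b / b) * ennreal ((1 + \<xi>\<^sup>2) powr r * (cmod (U \<xi>))\<^sup>2) \<partial>lborel)"
    using b by (simp flip: ennreal_mult add: mult_ac)
  also have "\<dots> = ennreal ((2 * K) powr b / b) * ennreal (LINT \<xi>|lborel. (1 + \<xi>\<^sup>2) powr r * (cmod (U \<xi>))\<^sup>2)"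
    by (subst nn_integral_cmult) (auto simp: nn_integral_eq_integral[OF Ui])
  also have "\<dots> \<le> ennreal ((2 * K) powr b / b) * ennreal 1"
    using U1 by (intro mult_left_mono ennreal_leI) auto
  finally have "(\<integral>\<^sup>+ x. ennreal (\<bar>u x\<bar> powr q) \<partial>lborel) \<le> ennreal b * (4 * (ennreal ((2 * K) powr b / b) * ennreal 1))"
    by (simp add: mult_left_mono)
  also have "\<dots> = 4 * (ennreal b * ennreal ((2 * K) powr b / b))"
    by (simp add: mult_ac)
  also have "ennreal b * ennreal ((2 * K) powr b / b) = ennreal ((2 * K) powr b)"
    using b by (simp flip: ennreal_mult)
  also have "4 * ennreal ((2 * K) powr b) = ennreal (sobolev_const r)"
    by (simp add: sobolev_const_def K_def b_def q_def ennreal_mult)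
  finally show ?thesis by (simp add: q_def)
qed

section \<open>Regularity of weak solutions\<close>

lemma assumption_A_measurable:
  assumes "assumption_A s m"
  shows "m \<in> borel_measurable borel"
proof -
  from assms obtain D where "finite D" "continuous_on (UNIV - D) m" by (auto simp: assumption_A_def)
  then show ?thesis
    by (intro borel_measurable_continuous_countable_exceptions[of D]) (auto simp: countable_finite Compl_eq_Diff_UNIV)
qed

lemma assumption_A_nonneg_upper:
  assumes "assumption_A s m"
  obtains C where "\<And>\<xi>. 0 \<le> m \<xi>" "\<And>\<xi>. m \<xi> \<le> C * (1 + \<xi>\<^sup>2) powr (s / 2)"
proof -
  from assms obtain A1 A2 where s: "s > 0" and A: "A1 > 0" "A2 > 0"
    and hi: "\<And>\<xi>. \<bar>\<xi>\<bar> \<ge> 1 \<Longrightarrow> A1 * \<bar>\<xi>\<bar> powr s \<le> m \<xi> \<and> m \<xi> \<le> A2 * \<bar>\<xi>\<bar> powr s"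
    and lo: "\<And>\<xi>. \<bar>\<xi>\<bar> \<le> 1 \<Longrightarrow> 0 \<le> m \<xi> \<and> m \<xi> \<le> A2"
    unfolding assumption_A_def by blast
  show thesis
  proof (rule that)
    fix \<xi>
    show "0 \<le> m \<xi>"
    proof (cases "\<bar>\<xi>\<bar> \<le> 1")
      case False
      then have "0 \<le> A1 * \<bar>\<xi>\<bar> powr s" using A by simp
      then show ?thesis using hi[of \<xi>] False by linarith
    qed (use lo in auto)
    show "m \<xi> \<le> A2 * (1 + \<xi>\<^sup>2) powr (s / 2)"
    proof (cases "\<bar>\<xi>\<bar> \<le> 1")
      case True
      have "1 \<le> (1 + \<xi>\<^sup>2) powr (s / 2)" using s by (intro ge_one_powr_ge_zero) auto
      then have "A2 * 1 \<le> A2 * (1 + \<xi>\<^sup>2) powr (s / 2)" using A by (intro mult_left_mono) auto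
      then show ?thesis using lo[OF True] by linarith
    next
      case False
      have "\<bar>\<xi>\<bar> powr s = (\<xi>\<^sup>2) powr (s / 2)" by (simp add: power2_powr)
      also have "\<dots> \<le> (1 + \<xi>\<^sup>2) powr (s / 2)" using s by (intro powr_mono2) auto
      finally have "A2 * \<bar>\<xi>\<bar> powr s \<le> A2 * (1 + \<xi>\<^sup>2) powr (s / 2)" using A by (intro mult_left_mono) auto
      then show ?thesis using hi[of \<xi>] False by linarith
    qed
  qed
qed

text \<open>The zero-order term \<open>b\<close> carries the low frequencies, where \<open>m\<close>
  may vanish, and \<open>a * m\<close> carries the high ones. The divisor
  \<open>2 powr (s / 2)\<close> in \<open>k\<close> comes from
  \<open>1 + \<xi>\<^sup>2 \<le> 2 * max 1 (\<xi>\<^sup>2)\<close>.\<close>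

lemma assumption_A_elliptic:
  assumes "assumption_A s m" and ab: "a > 0" "b > 0"
  obtains k where "k > 0" "\<And>\<xi>. k * (1 + \<xi>\<^sup>2) powr (s / 2) \<le> a * m \<xi> + b"
proof -
  from assms(1) obtain A1 A2 where s: "s > 0" and A: "A1 > 0" "A2 > 0"
    and hi: "\<And>\<xi>. \<bar>\<xi>\<bar> \<ge> 1 \<Longrightarrow> A1 * \<bar>\<xi>\<bar> powr s \<le> m \<xi> \<and> m \<xi> \<le> A2 * \<bar>\<xi>\<bar> powr s"
    and lo: "\<And>\<xi>. \<bar>\<xi>\<bar> \<le> 1 \<Longrightarrow> 0 \<le> m \<xi> \<and> m \<xi> \<le> A2"
    unfolding assumption_A_def by blast
  define c where "c = min b (a * A1)"
  define k where "k = c / 2 powr (s / 2)"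
  have c: "c > 0" using ab A by (simp add: c_def)
  show thesis
  proof (rule that)
    show "k > 0" using c by (simp add: k_def)
    fix \<xi> :: real
    show "k * (1 + \<xi>\<^sup>2) powr (s / 2) \<le> a * m \<xi> + b"
    proof (cases "\<bar>\<xi>\<bar> \<le> 1")
      case True
      then have "\<xi>\<^sup>2 \<le> 1" by (simp add: abs_square_le_1)
      then have "(1 + \<xi>\<^sup>2) powr (s / 2) \<le> 2 powr (s / 2)" using s by (intro powr_mono2) auto
      then have "k * (1 + \<xi>\<^sup>2) powr (s / 2) \<le> k * 2 powr (s / 2)" using \<open>k > 0\<close> by (intro mult_left_mono) auto
      also have "\<dots> = c" by (simp add: k_def)
      also have "c \<le> a * m \<xi> + b" using lo[OF True] ab by (simp add: c_def min.coboundedI1)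
      finally show ?thesis .
    next
      case False
      then have "1 \<le> \<xi>\<^sup>2" using one_le_power[of "\<bar>\<xi>\<bar>" 2] by simp
      then have "(1 + \<xi>\<^sup>2) powr (s / 2) \<le> (2 * \<xi>\<^sup>2) powr (s / 2)" using s by (intro powr_mono2) auto
      also have "\<dots> = 2 powr (s / 2) * \<bar>\<xi>\<bar> powr s" by (simp add: powr_mult power2_powr)
      finally have "k * (1 + \<xi>\<^sup>2) powr (s / 2) \<le> k * (2 powr (s / 2) * \<bar>\<xi>\<bar> powr s)"
        using \<open>k > 0\<close> by (intro mult_left_mono) auto
      also have "\<dots> = c * \<bar>\<xi>\<bar> powr s" by (simp add: k_def)
      also have "\<dots> \<le> a * A1 * \<bar>\<xi>\<bar> powr s" by (intro mult_right_mono) (auto simp: c_def)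
      also have "\<dots> \<le> a * m \<xi>" using hi[of \<xi>] False ab by (simp add: mult.assoc)
      finally show ?thesis using ab by simp
    qed
  qed
qed

section \<open>Truncated frequency weights and the energy estimate\<close>

lemma integrable_cutoff_mult:
  fixes h :: "real \<Rightarrow> real"
  assumes [measurable]: "w \<in> borel_measurable borel" and h: "integrable lborel h"
    and w: "\<And>\<xi>. \<bar>w \<xi>\<bar> \<le> (B::real)"
  shows "integrable lborel (\<lambda>\<xi>. w \<xi> * h \<xi>)"
proof (rule Bochner_Integration.integrable_bound)
  have [measurable]: "h \<in> borel_measurable borel" using h by auto
  show "integrable lborel (\<lambda>\<xi>. B * h \<xi>)" using h by simp
  show "AE \<xi> in lborel. norm (w \<xi> * h \<xi>) \<le> norm (B * h \<xi>)"
  proof (rule AE_I2)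
    fix \<xi>
    have "\<bar>w \<xi>\<bar> * \<bar>h \<xi>\<bar> \<le> \<bar>B\<bar> * \<bar>h \<xi>\<bar>" using w[of \<xi>] by (intro mult_right_mono) auto
    then show "norm (w \<xi> * h \<xi>) \<le> norm (B * h \<xi>)" by (simp add: abs_mult)
  qed
  show "(\<lambda>\<xi>. w \<xi> * h \<xi>) \<in> borel_measurable lborel" by measurable
qed

text \<open>A cut-off power of the Japanese bracket; \<open>e\<close> counts powers of
  \<open>1 + \<xi>\<^sup>2\<close>, so it corresponds to a multiplier of order 2e. The cut makes it
  bounded for positive \<open>e\<close> as well and keeps exponents additive.\<close>

definition japanese_cut :: "nat \<Rightarrow> real \<Rightarrow> real \<Rightarrow> real" where
  "japanese_cut N e \<xi> = (if \<bar>\<xi>\<bar> \<le> real N then (1 + \<xi>\<^sup>2) powr e else 0)"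

lemma borel_measurable_japanese_cut [measurable]: "japanese_cut N e \<in> borel_measurable borel"
  unfolding japanese_cut_def[abs_def] by measurable

lemma japanese_cut_nonneg [simp]: "0 \<le> japanese_cut N e \<xi>"
  by (simp add: japanese_cut_def)

lemma japanese_cut_even: "japanese_cut N e (- \<xi>) = japanese_cut N e \<xi>"
  by (simp add: japanese_cut_def)

lemma japanese_cut_mult: "japanese_cut N e \<xi> * japanese_cut N e' \<xi> = japanese_cut N (e + e') \<xi>"
  by (simp add: japanese_cut_def powr_add)

lemma powr_mult_japanese_cut: "(1 + \<xi>\<^sup>2) powr e * japanese_cut N e' \<xi> = japanese_cut N (e + e') \<xi>"
  by (simp add: japanese_cut_def powr_add)

lemma japanese_cut_bounded: "\<bar>japanese_cut N e \<xi>\<bar> \<le> (1 + (real N)\<^sup>2) powr \<bar>e\<bar>"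
proof (cases "\<bar>\<xi>\<bar> \<le> real N")
  case True
  then have "\<xi>\<^sup>2 \<le> (real N)\<^sup>2" by (metis abs_ge_zero power2_abs power_mono)
  have "(1 + \<xi>\<^sup>2) powr e \<le> (1 + \<xi>\<^sup>2) powr \<bar>e\<bar>" by (intro powr_mono) auto
  also have "\<dots> \<le> (1 + (real N)\<^sup>2) powr \<bar>e\<bar>" using \<open>\<xi>\<^sup>2 \<le> (real N)\<^sup>2\<close> by (intro powr_mono2) auto
  finally show ?thesis using True by (simp add: japanese_cut_def)
qed (simp add: japanese_cut_def)

lemma integrable_japanese_cut:
  assumes "integrable lborel h"
  shows "integrable lborel (\<lambda>\<xi>. japanese_cut N e \<xi> * h \<xi>)"
  by (rule integrable_cutoff_mult[OF _ assms japanese_cut_bounded]) measurable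

text \<open>Everything nonlinear is isolated in the constant \<open>K\<close>; what remains is
  linear elliptic regularity for the symbol \<open>a * m + b\<close>.\<close>

lemma weak_solution_regularity:
  assumes A: "assumption_A s m" and ab: "a > 0" "b > 0"
    and [measurable]: "u \<in> borel_measurable borel" and u: "integrable lborel (\<lambda>x. (u x)\<^sup>2)"
    and U: "is_fourier u U" and weak: "weak_solution s m f a b u"
    and K: "\<And>\<phi> V. \<phi> \<in> borel_measurable borel \<Longrightarrow> integrable lborel (\<lambda>x. (\<phi> x)\<^sup>2) \<Longrightarrow> is_fourier \<phi> V \<Longrightarrow>
      integrable lborel (\<lambda>\<xi>. (1 + \<xi>\<^sup>2) powr \<sigma> * (cmod (V \<xi>))\<^sup>2) \<Longrightarrow>
      (LINT \<xi>|lborel. (1 + \<xi>\<^sup>2) powr \<sigma> * (cmod (V \<xi>))\<^sup>2) \<le> 1 \<Longrightarrow> \<bar>LINT x|lborel. f (u x) * \<phi> x\<bar> \<le> K"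
  shows "integrable lborel (\<lambda>\<xi>. (1 + \<xi>\<^sup>2) powr (s - \<sigma>) * (cmod (U \<xi>))\<^sup>2)"
proof -
  have [measurable]: "U \<in> borel_measurable borel" using U by (auto simp: is_fourier_def)
  have [measurable]: "m \<in> borel_measurable borel" by (rule assumption_A_measurable[OF A])
  note U2 = integrable_norm_fourier_square[OF assms(4) u U]
  obtain k where k: "k > 0" "\<And>\<xi>. k * (1 + \<xi>\<^sup>2) powr (s / 2) \<le> a * m \<xi> + b"
    using assumption_A_elliptic[OF A ab] by blast
  obtain C where m: "\<And>\<xi>. 0 \<le> m \<xi>" "\<And>\<xi>. m \<xi> \<le> C * (1 + \<xi>\<^sup>2) powr (s / 2)"
    using assumption_A_nonneg_upper[OF A] by blast
  define t where "t = s - \<sigma>"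
  note J = integrable_japanese_cut[OF U2]
  define E where "E = (\<lambda>N. LINT \<xi>|lborel. japanese_cut N t \<xi> * (cmod (U \<xi>))\<^sup>2)"
  have E0: "E N \<ge> 0" for N unfolding E_def by (intro integral_nonneg_AE) auto
  have E: "E N \<le> (K / k)\<^sup>2" for N
  proof (cases "E N = 0")
    case False
    \<comment> \<open>The normaliser of the test function, which is why vanishing energy is treated
      apart.\<close>
    define e where "e = sqrt (E N)"
    have e: "e > 0" "e * e = E N" using E0[of N] False by (auto simp: e_def)
    \<comment> \<open>The exponent \<open>t - s / 2\<close> meets two demands: multiplied by the
      elliptic weight of exponent \<open>s / 2\<close> it gives \<open>t\<close>, and twice it plus
      \<sigma> is again \<open>t\<close>. So the form is at least \<open>k * E N / e\<close>, while
      the test function has unit norm in H^\<sigma>.\<close>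
    define w where "w = (\<lambda>\<xi>. japanese_cut N (t - s / 2) \<xi> / e)"
    have [measurable]: "w \<in> borel_measurable borel" unfolding w_def by measurable
    have w0: "w \<xi> \<ge> 0" for \<xi> using e by (simp add: w_def)
    have wb: "\<bar>w \<xi>\<bar> \<le> (1 + (real N)\<^sup>2) powr \<bar>t - s / 2\<bar> / e" for \<xi>
      using japanese_cut_bounded[of N "t - s / 2" \<xi>] e by (simp add: w_def divide_right_mono)
    have weven: "w (- \<xi>) = w \<xi>" for \<xi> by (simp add: w_def japanese_cut_even)
    have wout: "w \<xi> = 0" if "\<bar>\<xi>\<bar> > real N" for \<xi> using that by (simp add: w_def japanese_cut_def)
    obtain \<phi> where [measurable]: "\<phi> \<in> borel_measurable borel" and \<phi>: "integrable lborel (\<lambda>x. (\<phi> x)\<^sup>2)"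
      and V: "is_fourier \<phi> (\<lambda>\<xi>. complex_of_real (w \<xi>) * U \<xi>)"
      by (rule frequency_cutoff[OF assms(4) u U \<open>w \<in> _\<close> weven wb wout])
    have V2: "(1 + \<xi>\<^sup>2) powr d * (cmod (complex_of_real (w \<xi>) * U \<xi>))\<^sup>2
        = 1 / (e * e) * (japanese_cut N (d + (2 * t - s)) \<xi> * (cmod (U \<xi>))\<^sup>2)" for d \<xi>
    proof -
      have "(w \<xi>)\<^sup>2 = 1 / (e * e) * japanese_cut N (2 * t - s) \<xi>"
        by (simp add: w_def power2_eq_square japanese_cut_mult)
      then have "(1 + \<xi>\<^sup>2) powr d * (w \<xi>)\<^sup>2 = 1 / (e * e) * japanese_cut N (d + (2 * t - s)) \<xi>"
        by (simp add: powr_mult_japanese_cut)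
      then show ?thesis using w0[of \<xi>] by (simp add: norm_mult power_mult_distrib flip: mult.assoc)
    qed
    \<comment> \<open>Thanks to the cutoff every order \<open>d\<close> is allowed: \<sigma> serves
      the bound by \<open>K\<close>, and \<open>s / 2\<close> makes the test function
      admissible.\<close>
    have Vi: "integrable lborel (\<lambda>\<xi>. (1 + \<xi>\<^sup>2) powr d * (cmod (complex_of_real (w \<xi>) * U \<xi>))\<^sup>2)" for d
      unfolding V2 by (intro integrable_mult_right J)
    have "(LINT \<xi>|lborel. (1 + \<xi>\<^sup>2) powr \<sigma> * (cmod (complex_of_real (w \<xi>) * U \<xi>))\<^sup>2) = 1 / (e * e) * E N"
      unfolding V2 by (simp add: E_def t_def)
    also have "\<dots> \<le> 1" using e by simp
    finally have fK: "\<bar>LINT x|lborel. f (u x) * \<phi> x\<bar> \<le> K"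
      by (intro K[OF _ \<phi> V Vi]) auto
    have "\<phi> \<in> sobolev (s / 2)"
      unfolding sobolev_def
      by (intro CollectI conjI exI[of _ "\<lambda>\<xi>. complex_of_real (w \<xi>) * U \<xi>"] \<phi> V Vi) measurable
    then have eq: "complex_of_real a * (LINT \<xi>|lborel. complex_of_real (m \<xi>) * U \<xi> * cnj (complex_of_real (w \<xi>) * U \<xi>))
        + complex_of_real (b * (LINT x|lborel. u x * \<phi> x)) - complex_of_real (LINT x|lborel. f (u x) * \<phi> x) = 0"
      by (intro weak[unfolded weak_solution_def, rule_format] U V)
    have p: "complex_of_real (m \<xi>) * U \<xi> * cnj (complex_of_real (w \<xi>) * U \<xi>) = complex_of_real (m \<xi> * (w \<xi> * (cmod (U \<xi>))\<^sup>2))" for \<xi>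
      by (simp add: complex_norm_square mult_ac del: of_real_power)
    have p': "U \<xi> * cnj (complex_of_real (w \<xi>) * U \<xi>) = complex_of_real (w \<xi> * (cmod (U \<xi>))\<^sup>2)" for \<xi>
      by (simp add: complex_norm_square mult_ac del: of_real_power)
    have up: "(LINT x|lborel. u x * \<phi> x) = (LINT \<xi>|lborel. w \<xi> * (cmod (U \<xi>))\<^sup>2)"
      using is_fourier_parseval[OF assms(4) \<open>\<phi> \<in> borel_measurable borel\<close> u \<phi> U V] by (simp only: p' integral_complex_of_real Re_complex_of_real)
    have wi: "integrable lborel (\<lambda>\<xi>. w \<xi> * (cmod (U \<xi>))\<^sup>2)"
      by (rule integrable_cutoff_mult[OF _ U2 wb]) measurable
    have mi: "integrable lborel (\<lambda>\<xi>. m \<xi> * (w \<xi> * (cmod (U \<xi>))\<^sup>2))"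
    proof (rule Bochner_Integration.integrable_bound)
      show "integrable lborel (\<lambda>\<xi>. C / e * (japanese_cut N (s / 2 + (t - s / 2)) \<xi> * (cmod (U \<xi>))\<^sup>2))"
        by (intro integrable_mult_right J)
      show "AE \<xi> in lborel. norm (m \<xi> * (w \<xi> * (cmod (U \<xi>))\<^sup>2)) \<le> norm (C / e * (japanese_cut N (s / 2 + (t - s / 2)) \<xi> * (cmod (U \<xi>))\<^sup>2))"
      proof (rule AE_I2)
        fix \<xi>
        have "m \<xi> * (w \<xi> * (cmod (U \<xi>))\<^sup>2) \<le> (C * (1 + \<xi>\<^sup>2) powr (s / 2)) * (w \<xi> * (cmod (U \<xi>))\<^sup>2)"
          using m w0 by (intro mult_right_mono) auto
        also have "\<dots> = C / e * (((1 + \<xi>\<^sup>2) powr (s / 2) * japanese_cut N (t - s / 2) \<xi>) * (cmod (U \<xi>))\<^sup>2)"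
          by (simp add: w_def)
        finally have "m \<xi> * (w \<xi> * (cmod (U \<xi>))\<^sup>2) \<le> C / e * (japanese_cut N (s / 2 + (t - s / 2)) \<xi> * (cmod (U \<xi>))\<^sup>2)"
          by (simp only: powr_mult_japanese_cut)
        moreover have "0 \<le> m \<xi> * (w \<xi> * (cmod (U \<xi>))\<^sup>2)" using m(1)[of \<xi>] w0[of \<xi>] by simp
        ultimately show "norm (m \<xi> * (w \<xi> * (cmod (U \<xi>))\<^sup>2)) \<le> norm (C / e * (japanese_cut N (s / 2 + (t - s / 2)) \<xi> * (cmod (U \<xi>))\<^sup>2))"
          unfolding real_norm_def by (metis abs_ge_self abs_of_nonneg order_trans)
      qed
    qed measurable
    have "complex_of_real (a * (LINT \<xi>|lborel. m \<xi> * (w \<xi> * (cmod (U \<xi>))\<^sup>2)) + b * (LINT \<xi>|lborel. w \<xi> * (cmod (U \<xi>))\<^sup>2))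
        = complex_of_real (LINT x|lborel. f (u x) * \<phi> x)"
      using eq unfolding p up integral_complex_of_real by simp
    then have "(LINT x|lborel. f (u x) * \<phi> x) = a * (LINT \<xi>|lborel. m \<xi> * (w \<xi> * (cmod (U \<xi>))\<^sup>2)) + b * (LINT \<xi>|lborel. w \<xi> * (cmod (U \<xi>))\<^sup>2)"
      by (simp only: of_real_eq_iff)
    also have "\<dots> = (LINT \<xi>|lborel. a * (m \<xi> * (w \<xi> * (cmod (U \<xi>))\<^sup>2)) + b * (w \<xi> * (cmod (U \<xi>))\<^sup>2))"
      using mi wi by simp
    \<comment> \<open>Ellipticity, applied pointwise since \<open>w\<close> is nonnegative.\<close>
    also have "\<dots> \<ge> (LINT \<xi>|lborel. k / e * (japanese_cut N t \<xi> * (cmod (U \<xi>))\<^sup>2))"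
    proof (rule integral_mono)
      show "integrable lborel (\<lambda>\<xi>. k / e * (japanese_cut N t \<xi> * (cmod (U \<xi>))\<^sup>2))"
        by (intro integrable_mult_right J)
      show "integrable lborel (\<lambda>\<xi>. a * (m \<xi> * (w \<xi> * (cmod (U \<xi>))\<^sup>2)) + b * (w \<xi> * (cmod (U \<xi>))\<^sup>2))"
        using mi wi by simp
      fix \<xi>
      have "k / e * (japanese_cut N t \<xi> * (cmod (U \<xi>))\<^sup>2) = (k * (1 + \<xi>\<^sup>2) powr (s / 2)) * (w \<xi> * (cmod (U \<xi>))\<^sup>2)"
        using powr_mult_japanese_cut[of \<xi> "s / 2" N "t - s / 2"] by (simp add: w_def)
      also have "\<dots> \<le> (a * m \<xi> + b) * (w \<xi> * (cmod (U \<xi>))\<^sup>2)"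
        using k(2)[of \<xi>] w0[of \<xi>] by (intro mult_right_mono) auto
      finally show "k / e * (japanese_cut N t \<xi> * (cmod (U \<xi>))\<^sup>2) \<le> a * (m \<xi> * (w \<xi> * (cmod (U \<xi>))\<^sup>2)) + b * (w \<xi> * (cmod (U \<xi>))\<^sup>2)"
        by (simp add: algebra_simps)
    qed
    finally have "k / e * E N \<le> K" using fK by (simp add: E_def)
    moreover have "k / e * E N = k * e" using e(1) by (simp flip: e(2))
    ultimately have "e \<le> K / k" using k(1) by (simp add: pos_le_divide_eq mult.commute)
    then have "e * e \<le> (K / k) * (K / k)" using e by (intro mult_mono) auto
    then show ?thesis using e by (simp add: power2_eq_square)
  qed simp
  have lim: "(\<lambda>N. ennreal (japanese_cut N t \<xi> * (cmod (U \<xi>))\<^sup>2)) \<longlonglongrightarrow> ennreal ((1 + \<xi>\<^sup>2) powr t * (cmod (U \<xi>))\<^sup>2)" for \<xi>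
  proof (rule tendsto_eventually)
    show "\<forall>\<^sub>F N in sequentially. ennreal (japanese_cut N t \<xi> * (cmod (U \<xi>))\<^sup>2) = ennreal ((1 + \<xi>\<^sup>2) powr t * (cmod (U \<xi>))\<^sup>2)"
      by (rule eventually_sequentiallyI[of "nat \<lceil>\<bar>\<xi>\<bar>\<rceil>"]) (simp add: japanese_cut_def nat_le_iff ceiling_le_iff)
  qed
  have "(\<integral>\<^sup>+ \<xi>. ennreal ((1 + \<xi>\<^sup>2) powr t * (cmod (U \<xi>))\<^sup>2) \<partial>lborel)
      = (\<integral>\<^sup>+ \<xi>. liminf (\<lambda>N. ennreal (japanese_cut N t \<xi> * (cmod (U \<xi>))\<^sup>2)) \<partial>lborel)"
    by (intro nn_integral_cong lim_imp_Liminf[symmetric] lim) simp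
  also have "\<dots> \<le> liminf (\<lambda>N. \<integral>\<^sup>+ \<xi>. ennreal (japanese_cut N t \<xi> * (cmod (U \<xi>))\<^sup>2) \<partial>lborel)"
    by (rule nn_integral_liminf) measurable
  also have "\<dots> \<le> liminf (\<lambda>N::nat. ennreal ((K / k)\<^sup>2))"
  proof (intro Liminf_mono always_eventually allI)
    fix N
    show "(\<integral>\<^sup>+ \<xi>. ennreal (japanese_cut N t \<xi> * (cmod (U \<xi>))\<^sup>2) \<partial>lborel) \<le> ennreal ((K / k)\<^sup>2)"
      using E[of N] by (subst nn_integral_eq_integral[OF J]) (auto simp: E_def intro: ennreal_leI)
  qed
  also have "\<dots> < \<infinity>" by (simp add: Liminf_const)
  finally show ?thesis
    unfolding t_def by (intro integrableI_bounded) auto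
qed

section \<open>Lebesgue bounds for the solution and the test functions\<close>

lemma sobolev_embedding_integrable:
  assumes r: "0 < r" "r < 1 / 2"
    and [measurable]: "u \<in> borel_measurable borel" and u: "integrable lborel (\<lambda>x. (u x)\<^sup>2)"
    and U: "is_fourier u U"
    and Ui: "integrable lborel (\<lambda>\<xi>. (1 + \<xi>\<^sup>2) powr r * (cmod (U \<xi>))\<^sup>2)"
  shows "integrable lborel (\<lambda>x. \<bar>u x\<bar> powr (2 / (1 - 2 * r)))"
proof -
  have [measurable]: "U \<in> borel_measurable borel" using U by (auto simp: is_fourier_def)
  define I where "I = (LINT \<xi>|lborel. (1 + \<xi>\<^sup>2) powr r * (cmod (U \<xi>))\<^sup>2)"
  have I0: "I \<ge> 0" unfolding I_def by (intro integral_nonneg_AE) auto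
  \<comment> \<open>A scaling that brings the weighted norm below 1:
    \<open>c\<^sup>2 * I \<le> 1\<close>, and adding 1 covers the case that \<open>I\<close>
    vanishes.\<close>
  define c where "c = 1 / (I + 1)"
  have c: "c > 0" "c \<le> 1" "c * I \<le> 1" using I0 by (auto simp: c_def field_simps)
  have F: "is_fourier (\<lambda>x. c * u x) (\<lambda>\<xi>. complex_of_real c * U \<xi>)"
    using is_fourier_linear[OF assms(3) assms(3) u u U U, of c 0] by simp
  have eq: "(1 + \<xi>\<^sup>2) powr r * (cmod (complex_of_real c * U \<xi>))\<^sup>2 = c\<^sup>2 * ((1 + \<xi>\<^sup>2) powr r * (cmod (U \<xi>))\<^sup>2)" for \<xi>
    by (simp add: norm_mult power_mult_distrib)
  have "(LINT \<xi>|lborel. c\<^sup>2 * ((1 + \<xi>\<^sup>2) powr r * (cmod (U \<xi>))\<^sup>2)) = c * (c * I)"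
    by (simp add: I_def power2_eq_square)
  also have "\<dots> \<le> 1" using mult_le_one[of c "c * I"] c I0 by simp
  finally have "(\<integral>\<^sup>+ x. ennreal (\<bar>c * u x\<bar> powr (2 / (1 - 2 * r))) \<partial>lborel) \<le> ennreal (sobolev_const r)"
    using u Ui by (intro sobolev_embedding[OF r _ _ F]) (simp_all add: eq power_mult_distrib)
  then have "integrable lborel (\<lambda>x. \<bar>c * u x\<bar> powr (2 / (1 - 2 * r)))"
    by (intro integrableI_bounded) (auto intro: le_less_trans)
  then show ?thesis using c by (simp add: abs_mult powr_mult)
qed

text \<open>Order 0 stands apart because \<open>sobolev_embedding\<close> is for positive orders;
  there the exponent is 2 and Plancherel gives the constant 1. The last bootstrap step is exactly
  this case.\<close>

lemma sobolev_dual_bound: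
  assumes \<sigma>: "0 \<le> \<sigma>" "\<sigma> < 1 / 2"
  obtains C where "\<And>\<phi> V. \<phi> \<in> borel_measurable borel \<Longrightarrow> integrable lborel (\<lambda>x. (\<phi> x)\<^sup>2) \<Longrightarrow> is_fourier \<phi> V \<Longrightarrow>
      integrable lborel (\<lambda>\<xi>. (1 + \<xi>\<^sup>2) powr \<sigma> * (cmod (V \<xi>))\<^sup>2) \<Longrightarrow>
      (LINT \<xi>|lborel. (1 + \<xi>\<^sup>2) powr \<sigma> * (cmod (V \<xi>))\<^sup>2) \<le> 1 \<Longrightarrow>
      integrable lborel (\<lambda>x. \<bar>\<phi> x\<bar> powr (2 / (1 - 2 * \<sigma>))) \<and> (LINT x|lborel. \<bar>\<phi> x\<bar> powr (2 / (1 - 2 * \<sigma>))) \<le> C"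
proof (cases "\<sigma> = 0")
  case True
  show thesis
  proof (rule that[of 1])
    fix \<phi> :: "real \<Rightarrow> real" and V
    assume a: "\<phi> \<in> borel_measurable borel" "integrable lborel (\<lambda>x. (\<phi> x)\<^sup>2)" "is_fourier \<phi> V"
      "(LINT \<xi>|lborel. (1 + \<xi>\<^sup>2) powr \<sigma> * (cmod (V \<xi>))\<^sup>2) \<le> 1"
    \<comment> \<open>Since \<open>0 powr 0\<close> is 0, the positivity of the base has to be
      invoked.\<close>
    have J1: "(1 + \<xi>\<^sup>2) powr 0 = (1::real)" for \<xi> :: real
      using zero_le_power2[of \<xi>] by (simp add: powr_zero_eq_one add_nonneg_eq_0_iff)
    have e: "\<bar>\<phi> x\<bar> powr 2 = (\<phi> x)\<^sup>2" for x by (cases "\<phi> x = 0") auto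
    have "(LINT x|lborel. (\<phi> x)\<^sup>2) \<le> 1"
      using a(4) integral_norm_fourier_square[OF a(1-3)] True J1 by simp
    then show "integrable lborel (\<lambda>x. \<bar>\<phi> x\<bar> powr (2 / (1 - 2 * \<sigma>))) \<and> (LINT x|lborel. \<bar>\<phi> x\<bar> powr (2 / (1 - 2 * \<sigma>))) \<le> 1"
      using a(2) True e by simp
  qed
next
  case False
  then have \<sigma>': "\<sigma> > 0" using \<sigma> by simp
  show thesis
  proof (rule that[of "sobolev_const \<sigma>"])
    fix \<phi> :: "real \<Rightarrow> real" and V
    assume a: "\<phi> \<in> borel_measurable borel" "integrable lborel (\<lambda>x. (\<phi> x)\<^sup>2)" "is_fourier \<phi> V"
      "integrable lborel (\<lambda>\<xi>. (1 + \<xi>\<^sup>2) powr \<sigma> * (cmod (V \<xi>))\<^sup>2)"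
      "(LINT \<xi>|lborel. (1 + \<xi>\<^sup>2) powr \<sigma> * (cmod (V \<xi>))\<^sup>2) \<le> 1"
    note i = sobolev_embedding_integrable[OF \<sigma>' \<sigma>(2) a(1-4)]
    have "ennreal (LINT x|lborel. \<bar>\<phi> x\<bar> powr (2 / (1 - 2 * \<sigma>))) \<le> ennreal (sobolev_const \<sigma>)"
      using sobolev_embedding[OF \<sigma>' \<sigma>(2) a] by (subst nn_integral_eq_integral[OF i, symmetric]) auto
    moreover have "sobolev_const \<sigma> \<ge> 0" by (simp add: sobolev_const_def)
    ultimately show "integrable lborel (\<lambda>x. \<bar>\<phi> x\<bar> powr (2 / (1 - 2 * \<sigma>))) \<and> (LINT x|lborel. \<bar>\<phi> x\<bar> powr (2 / (1 - 2 * \<sigma>))) \<le> sobolev_const \<sigma>"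
      using i by simp
  qed
qed

text \<open>Both kinds of nonlinearity enter the pairing estimate through this growth bound.\<close>

lemma assumption_B_bound:
  assumes "assumption_B p f"
  obtains c where "c \<ge> 0" "\<And>y. \<bar>f y\<bar> \<le> c * \<bar>y\<bar> powr p"
proof -
  from assms consider cp where "cp > 0" "f = (\<lambda>u. cp * u * \<bar>u\<bar> powr (p - 1))"
    | cp where "f = (\<lambda>u. cp * \<bar>u\<bar> powr p)" by (auto simp: assumption_B_def)
  then show thesis
  proof cases
    case 1
    have "\<bar>f y\<bar> = cp * \<bar>y\<bar> powr p" for y
      using 1 by (cases "y = 0") (simp_all add: abs_mult powr_diff)
    then show thesis using 1 by (intro that[of cp]) auto
  next
    case 2
    then show thesis by (intro that[of "\<bar>cp\<bar>"]) (auto simp: abs_mult)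
  qed
qed

lemma assumption_B_measurable:
  assumes "assumption_B p f"
  shows "f \<in> borel_measurable borel"
  using assms by (auto simp: assumption_B_def)

text \<open>By Young's inequality with exponents 2/(p(1-2r)) and 2/(1-2\<sigma>).\<close>
lemma weak_solution_bootstrap:
  assumes A: "assumption_A s m" and B: "assumption_B p f" and ab: "a > 0" "b > 0"
    and [measurable]: "u \<in> borel_measurable borel" and u: "integrable lborel (\<lambda>x. (u x)\<^sup>2)"
    and U: "is_fourier u U" and weak: "weak_solution s m f a b u"
    and r: "0 < r" "r < 1 / 2" and Ui: "integrable lborel (\<lambda>\<xi>. (1 + \<xi>\<^sup>2) powr r * (cmod (U \<xi>))\<^sup>2)"
    and p: "1 \<le> p * (1 - 2 * r)" "p * (1 - 2 * r) < 2"
  shows "integrable lborel (\<lambda>\<xi>. (1 + \<xi>\<^sup>2) powr (s - (p * (1 - 2 * r) - 1) / 2) * (cmod (U \<xi>))\<^sup>2)"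
proof -
  have [measurable]: "f \<in> borel_measurable borel" by (rule assumption_B_measurable[OF B])
  \<comment> \<open>Determined by the conjugacy \<open>1 / q + 1 / q' = 1\<close>, which reads
    \<open>p * (1 - 2 * r) + (1 - 2 * \<sigma>) = 2\<close>. The two hypotheses on
    \<open>p * (1 - 2 * r)\<close> say that \<sigma> lies in the range of
    \<open>sobolev_dual_bound\<close>.\<close>
  define \<sigma> where "\<sigma> = (p * (1 - 2 * r) - 1) / 2"
  have \<sigma>: "0 \<le> \<sigma>" "\<sigma> < 1 / 2" using p by (auto simp: \<sigma>_def)
  define q where "q = 2 / (p * (1 - 2 * r))"
  define q' where "q' = 2 / (1 - 2 * \<sigma>)"
  have p0: "p > 0" using B by (simp add: assumption_B_def)
  have q: "q > 1" "q' > 1" "1 / q + 1 / q' = 1"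
    using p \<sigma> by (auto simp: q_def q'_def \<sigma>_def field_simps)
  \<comment> \<open>The embedding exponent of order \<open>r\<close>, so that
    \<open>\<bar>u x\<bar> powr p\<close> is in L^q.\<close>
  have pq: "p * q = 2 / (1 - 2 * r)" using p0 by (simp add: q_def)
  obtain c where c: "c \<ge> 0" "\<And>y. \<bar>f y\<bar> \<le> c * \<bar>y\<bar> powr p" using assumption_B_bound[OF B] by blast
  obtain C where C: "\<And>\<phi> V. \<phi> \<in> borel_measurable borel \<Longrightarrow> integrable lborel (\<lambda>x. (\<phi> x)\<^sup>2) \<Longrightarrow> is_fourier \<phi> V \<Longrightarrow>
      integrable lborel (\<lambda>\<xi>. (1 + \<xi>\<^sup>2) powr \<sigma> * (cmod (V \<xi>))\<^sup>2) \<Longrightarrow>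
      (LINT \<xi>|lborel. (1 + \<xi>\<^sup>2) powr \<sigma> * (cmod (V \<xi>))\<^sup>2) \<le> 1 \<Longrightarrow>
      integrable lborel (\<lambda>x. \<bar>\<phi> x\<bar> powr q') \<and> (LINT x|lborel. \<bar>\<phi> x\<bar> powr q') \<le> C"
    unfolding q'_def using sobolev_dual_bound[OF \<sigma>] by blast
  have ui: "integrable lborel (\<lambda>x. \<bar>u x\<bar> powr (p * q))"
    unfolding pq by (rule sobolev_embedding_integrable[OF r assms(5) u U Ui])
  define M where "M = (LINT x|lborel. \<bar>u x\<bar> powr (p * q))"
  have "integrable lborel (\<lambda>\<xi>. (1 + \<xi>\<^sup>2) powr (s - \<sigma>) * (cmod (U \<xi>))\<^sup>2)"
  proof (rule weak_solution_regularity[OF A ab assms(5) u U weak, where K="c * (M + C)"])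
    fix \<phi> V
    assume a: "\<phi> \<in> borel_measurable borel" "integrable lborel (\<lambda>x. (\<phi> x)\<^sup>2)" "is_fourier \<phi> V"
      "integrable lborel (\<lambda>\<xi>. (1 + \<xi>\<^sup>2) powr \<sigma> * (cmod (V \<xi>))\<^sup>2)"
      "(LINT \<xi>|lborel. (1 + \<xi>\<^sup>2) powr \<sigma> * (cmod (V \<xi>))\<^sup>2) \<le> 1"
    have [measurable]: "\<phi> \<in> borel_measurable borel" by fact
    have \<phi>: "integrable lborel (\<lambda>x. \<bar>\<phi> x\<bar> powr q')" "(LINT x|lborel. \<bar>\<phi> x\<bar> powr q') \<le> C" using C[OF a] by auto
    have bd: "\<bar>f (u x) * \<phi> x\<bar> \<le> c * (\<bar>u x\<bar> powr (p * q) + \<bar>\<phi> x\<bar> powr q')" for x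
    proof -
      have "\<bar>u x\<bar> powr p * \<bar>\<phi> x\<bar> \<le> (\<bar>u x\<bar> powr p) powr q / q + \<bar>\<phi> x\<bar> powr q' / q'"
        using q by (intro Youngs_inequality) auto
      also have "\<dots> \<le> \<bar>u x\<bar> powr (p * q) + \<bar>\<phi> x\<bar> powr q'"
        using q by (intro add_mono) (auto simp: powr_powr divide_le_eq mult_le_cancel_left1)
      finally have "c * (\<bar>u x\<bar> powr p * \<bar>\<phi> x\<bar>) \<le> c * (\<bar>u x\<bar> powr (p * q) + \<bar>\<phi> x\<bar> powr q')"
        using c by (intro mult_left_mono) auto
      moreover have "\<bar>f (u x) * \<phi> x\<bar> \<le> c * (\<bar>u x\<bar> powr p * \<bar>\<phi> x\<bar>)"
        using mult_right_mono[OF c(2)[of "u x"], of "\<bar>\<phi> x\<bar>"] by (simp add: abs_mult mult.assoc)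
      ultimately show ?thesis by linarith
    qed
    have gi: "integrable lborel (\<lambda>x. c * (\<bar>u x\<bar> powr (p * q) + \<bar>\<phi> x\<bar> powr q'))" using ui \<phi> by simp
    have "\<bar>LINT x|lborel. f (u x) * \<phi> x\<bar> \<le> (LINT x|lborel. \<bar>f (u x) * \<phi> x\<bar>)"
      using integral_norm_bound[of lborel "\<lambda>x. f (u x) * \<phi> x"] by simp
    also have "\<dots> \<le> (LINT x|lborel. c * (\<bar>u x\<bar> powr (p * q) + \<bar>\<phi> x\<bar> powr q'))"
      using c by (intro integral_mono'[OF gi bd]) simp
    also have "\<dots> = c * (M + (LINT x|lborel. \<bar>\<phi> x\<bar> powr q'))" using ui \<phi>(1) by (simp add: M_def)
    also have "\<dots> \<le> c * (M + C)" using c \<phi> by (intro mult_left_mono) auto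
    finally show "\<bar>LINT x|lborel. f (u x) * \<phi> x\<bar> \<le> c * (M + C)" .
  qed
  then show ?thesis by (simp add: \<sigma>_def)
qed

section \<open>Iteration up to full regularity\<close>

lemma integrable_japanese_mono:
  fixes U :: "real \<Rightarrow> complex"
  assumes [measurable]: "U \<in> borel_measurable borel"
    and "integrable lborel (\<lambda>\<xi>. (1 + \<xi>\<^sup>2) powr r' * (cmod (U \<xi>))\<^sup>2)" and "r \<le> r'"
  shows "integrable lborel (\<lambda>\<xi>. (1 + \<xi>\<^sup>2) powr r * (cmod (U \<xi>))\<^sup>2)"
  by (rule Bochner_Integration.integrable_bound[OF assms(2)])
    (use assms(3) in \<open>auto intro!: AE_I2 mult_right_mono powr_mono simp: abs_mult\<close>)

lemma weak_solution_in_sobolev: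
  assumes A: "assumption_A s m" and B: "assumption_B p f"
    and sub: "s < 1 \<longrightarrow> p < (1 + s) / (1 - s)"
    and u: "u \<in> sobolev (s / 2)" and ab: "a > 0" "b > 0" and weak: "weak_solution s m f a b u"
  shows "u \<in> sobolev s"
proof -
  have p: "p > 1" using B by (simp add: assumption_B_def)
  have s: "s > 0" using A by (simp add: assumption_A_def)
  from u obtain U where um[measurable]: "u \<in> borel_measurable borel" and u2: "integrable lborel (\<lambda>x. (u x)\<^sup>2)"
    and U: "is_fourier u U" and Us: "integrable lborel (\<lambda>\<xi>. (1 + \<xi>\<^sup>2) powr (s / 2) * (cmod (U \<xi>))\<^sup>2)"
    by (auto simp: sobolev_def)
  have [measurable]: "U \<in> borel_measurable borel" using U by (auto simp: is_fourier_def)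
  let ?H = "\<lambda>r. integrable lborel (\<lambda>\<xi>. (1 + \<xi>\<^sup>2) powr r * (cmod (U \<xi>))\<^sup>2)"
  note step = weak_solution_bootstrap[OF A B ab um u2 U weak]
  \<comment> \<open>The order at which \<sigma> becomes 0; it is below 1/2 for every
    \<open>p\<close>.\<close>
  define R where "R = (1 - 1 / p) / 2"
  have R: "0 < R" "R < 1 / 2" "p * (1 - 2 * R) = 1" using p by (auto simp: R_def field_simps)
  have HR: "?H R"
  \<comment> \<open>The first case includes all \<open>s \<ge> 1\<close>, where the initial
    regularity already reaches \<open>R\<close>; in the second, \<open>s < 1\<close> and the
    subcritical bound on \<open>p\<close> is available.\<close>
  proof (cases "R \<le> s / 2")
    case True
    show ?thesis by (rule integrable_japanese_mono[OF _ Us True]) measurable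
  next
    case False
    then have s1: "s < 1" "s / 2 < R" using R by auto
    then have ps: "p * (1 - s) < 1 + s" using sub by (simp add: field_simps)
    \<comment> \<open>The gain of one step from order \<open>r\<close> is
      \<open>s - (p - 1) * (1 - 2 * r) / 2\<close>, which grows with \<open>r\<close>;
      \<open>d\<close> is its value at the start \<open>r = s / 2\<close> and hence a uniform lower
      bound.\<close>
    define d where "d = s - (p - 1) * (1 - s) / 2"
    have d: "d > 0" using ps by (simp add: d_def algebra_simps)
    \<comment> \<open>Overshoot beyond \<open>R\<close> is discarded by the minimum, because a step
      needs \<open>p * (1 - 2 * r) \<ge> 1\<close>.\<close>
    have H: "?H (min R (s / 2 + real n * d))" for n
    proof (induction n)
      case 0
      show ?case using Us s1 by (simp add: min_def)
    next
      case (Suc n)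
      define r where "r = s / 2 + real n * d"
      show ?case
      proof (cases "R \<le> r")
        case True
        then have "?H R" using Suc by (simp add: r_def min_def)
        then show ?thesis by (rule integrable_japanese_mono[rotated]) auto
      next
        case False
        have rs: "s / 2 \<le> r" using d by (simp add: r_def)
        have "?H r" using Suc False by (simp add: r_def min_def)
        \<comment> \<open>The two comparisons confine \<open>p * (1 - 2 * r)\<close> between 1 and
          \<open>1 + s\<close>, hence below 2.\<close>
        moreover have "p * (1 - 2 * r) \<le> p * (1 - s)" using rs p by (intro mult_left_mono) auto
        moreover have "p * (1 - 2 * R) \<le> p * (1 - 2 * r)" using False p by (intro mult_left_mono) auto
        ultimately have "?H (s - (p * (1 - 2 * r) - 1) / 2)"
          using step[of r] False R rs s s1 ps by auto
        moreover have "r + d \<le> s - (p * (1 - 2 * r) - 1) / 2"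
          using mult_right_mono[OF rs, of "p - 1"] p by (simp add: d_def field_simps)
        ultimately show ?thesis
          by (elim integrable_japanese_mono[rotated]) (auto simp: r_def algebra_simps)
      qed
    qed
    obtain n where "R < real n * d" using reals_Archimedean3[OF d] by blast
    then have "min R (s / 2 + real n * d) = R" using s by simp
    then show ?thesis using H[of n] by simp
  qed
  \<comment> \<open>One more step, from \<open>R\<close> itself, where \<sigma> = 0 and the new
    order is exactly \<open>s\<close>.\<close>
  have "?H s" using step[OF R(1,2) HR] R(3) by simp
  then show ?thesis using um u2 U unfolding sobolev_def by auto
qed

theorem mainTheorem17:
  fixes s p c :: real and m f u :: "real \<Rightarrow> real"
  assumes "assumption_A s m"
    and "assumption_B p f"
    and "1 < p" and "s < 1 \<longrightarrow> p < (1 + s) / (1 - s)"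
    and "u \<in> sobolev (s / 2)"
    and "(c > 0 \<and> weak_solution s m f 1 c u) \<or>
         (c > 0 \<and> weak_solution s m f c c u) \<or>
         (c > 1 \<and> weak_solution s m f c (c - 1) u)"
  shows "u \<in> sobolev s"
  \<comment> \<open>In each alternative both coefficients are positive; in the third one,
    \<open>c > 1\<close> is what makes \<open>c - 1\<close> so.\<close>
  using assms(6) weak_solution_in_sobolev[OF assms(1,2,4,5), of 1 c]
    weak_solution_in_sobolev[OF assms(1,2,4,5), of c c]
    weak_solution_in_sobolev[OF assms(1,2,4,5), of c "c - 1"]
  by auto

end
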